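(* Let $D$ be the open unit ball of $Z=\mathbf C^d$, $n\in\mathbf N$, $\nu>0$. The general $G$-covariant kernel $\mathcal K^{\nu,\mathbf c}$, with arbitrary constants $\mathbf c=(c_\lambda)_{0\le\lambda\le n}$, $c_\lambda>0$, has at the origin the form $$\mathcal K^{\nu,\mathbf c}_{0,0}(\zeta,\omega)=\sum_{\ell=0}^n(\zeta|\omega)^\ell\sum_{\lambda=0}^\ell\kappa^\lambda_\ell(\nu)\,\frac{c_\lambda}{\lambda!},$$ where $(\kappa^\lambda_\ell)$ is the lower triangular matrix with universal coefficients $$\kappa^\lambda_\ell(\nu)=\left(\frac{(\lambda-n)_{\ell-\lambda}}{(\nu+2\lambda)_{\ell-\lambda}}\right)^2\sum_{i+j=\ell-\lambda}\binom{\nu+\ell-1}{i}\binom{\lambda}{j}.$$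
   Context: $D=\{z\in\mathbf C^d:(z|z)<1\}$, $(u|v)$ the standard inner product (linear in $u$, conjugate-linear in $v$); $\Delta_{z,w}=1-(z|w)$; $B_{z,w}\zeta=(1-(z|w))(\zeta-(\zeta|w)z)$; $\mathcal P_\lambda Z$ is the space of $\lambda$-homogeneous holomorphic polynomials in $\zeta\in Z$, with Fischer-Fock inner product $(\phi|\psi)_F=\int_Z\pi^{-d}e^{-(\omega|\omega)}\overline{\phi(\omega)}\psi(\omega)d\omega$, whose reproducing kernel is $\mathcal E^\lambda(\zeta,\omega)=(\zeta|\omega)^\lambda/\lambda!$. $\mathcal P^nZ=\sum_{\lambda=0}^n\mathcal P_\lambda Z$. $(s)_k=s(s+1)\cdots(s+k-1)$, and $\binom{s}{i}=s(s-1)\cdots(s-i+1)/i!$. $H^2_\nu(D,\mathcal P_\lambda Z)$ is the Hilbert space of holomorphic maps $z\mapsto\Phi_z\in\mathcal P_\lambda Z$ on $D$ with reproducing kernel given (as integral kernel with respect to $(\cdot|\cdot)_F$) by $\mathcal K^{\nu,\lambda}_{z,w}(\zeta,\omega)=\Delta_{z,w}^{-\nu}\,\mathcal E^\lambda(B_{z,w}^{-1}\zeta,\omega)$; thus $\mathcal K^{\nu,\lambda}_{z,w}(\zeta,\omega)=\sum_\alpha\Phi^\alpha_z(\zeta)\overline{\Phi^\alpha_w(\omega)}$ for any orthonormal basis $(\Phi^\alpha)$. The intertwiner $\mathcal I_\lambda$ maps $\mathcal P_\lambda Z$-valued to $\mathcal P^nZ$-valued holomorphic maps on $D$ by $\mathcal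 I_\lambda=\sum_{k=0}^{n-\lambda}\frac{(\lambda-n)_k}{(2\lambda+\nu)_k}\frac{(\zeta|\overline\partial)^k}{k!}$, where $(\zeta|\overline\partial)^k$ sends $f(z)\psi(\zeta)$ to $\psi(\zeta)\frac{d^k}{dt^k}|_{t=0}f(z+t\zeta)$. For $\mathbf c=(c_\lambda)_{0\le\lambda\le n}$ with $c_\lambda>0$, the (big) $G$-covariant kernel is $$\mathcal K^{\nu,\mathbf c}_{z,w}(\zeta,\omega)=\sum_{\lambda=0}^n c_\lambda\sum_\alpha(\mathcal I_\lambda\Phi^{\alpha})_z(\zeta)\,\overline{(\mathcal I_\lambda\Phi^{\alpha})_w(\omega)},$$ where for each $\lambda$, $(\Phi^\alpha)$ is an orthonormal basis of $H^2_\nu(D,\mathcal P_\lambda Z)$. All $G$-covariant kernels on the big Hilbert space arise in this way. *)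

theory Defs
  imports "HOL-Analysis.Analysis" "HOL-Library.Function_Algebras"
begin

section \<open>The unit ball and the basic kernels\<close>

text \<open>The space \<open>Z\<close> is \<open>complex ^ 'd\<close>, of dimension \<open>CARD('d)\<close>. The product below is linear in the
  first and conjugate-linear in the second argument. The library inner product on this type is
  the real one, \<open>Re (cdot u v)\<close>.\<close>

definition cdot :: "complex ^ 'd \<Rightarrow> complex ^ 'd \<Rightarrow> complex" where
  "cdot u v = (\<Sum>i\<in>UNIV. u $ i * cnj (v $ i))"

definition D :: "(complex ^ 'd) set" where
  "D = ball 0 1"

lemma cdot_self: "cdot z z = of_real ((norm z)\<^sup>2)"
  unfolding cdot_def norm_vec_def L2_set_def
  by (simp add: sum_nonneg complex_norm_square flip: of_real_power)

lemma mem_D_iff: "z \<in> D \<longleftrightarrow> Re (cdot z z) < 1"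
proof -
  have "z \<in> D \<longleftrightarrow> (norm z)\<^sup>2 < 1"
    by (simp add: D_def abs_square_less_1)
  also have "(norm z)\<^sup>2 = Re (cdot z z)"
    by (simp only: cdot_self Re_complex_of_real)
  finally show ?thesis .
qed

definition Delta :: "complex ^ 'd \<Rightarrow> complex ^ 'd \<Rightarrow> complex" where
  "Delta z w = 1 - cdot z w"

definition Bop :: "complex ^ 'd \<Rightarrow> complex ^ 'd \<Rightarrow> complex ^ 'd \<Rightarrow> complex ^ 'd" where
  "Bop z w \<zeta> = (1 - cdot z w) *s (\<zeta> - cdot \<zeta> w *s z)"

definition Ekernel :: "nat \<Rightarrow> complex ^ 'd \<Rightarrow> complex ^ 'd \<Rightarrow> complex" where
  "Ekernel l \<zeta> \<omega> = cdot \<zeta> \<omega> ^ l / fact l"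

text \<open>On \<open>D \<times> D\<close> the operator \<open>Bop z w\<close> is invertible, and \<open>Delta z w\<close> has positive real part, so
  that the principal branch of the power is meant.\<close>

definition Knl :: "real \<Rightarrow> nat \<Rightarrow> complex ^ 'd \<Rightarrow> complex ^ 'd \<Rightarrow> complex ^ 'd \<Rightarrow> complex ^ 'd \<Rightarrow> complex"
  where "Knl \<nu> l z w \<zeta> \<omega> = Delta z w powr (- of_real \<nu>) * Ekernel l (inv (Bop z w) \<zeta>) \<omega>"


section \<open>Homogeneous polynomials and the Fischer-Fock product\<close>

definition multi_indices :: "nat \<Rightarrow> ('d::finite \<Rightarrow> nat) set" where
  "multi_indices l = {\<alpha>. (\<Sum>i\<in>UNIV. \<alpha> i) = l}"

definition monomial :: "('d::finite \<Rightarrow> nat) \<Rightarrow> complex ^ 'd \<Rightarrow> complex" where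
  "monomial \<alpha> \<zeta> = (\<Prod>i\<in>UNIV. (\<zeta> $ i) ^ \<alpha> i)"

definition hom_polys :: "nat \<Rightarrow> (complex ^ 'd \<Rightarrow> complex) set" where
  "hom_polys l = {p. \<exists>a. \<forall>\<zeta>. p \<zeta> = (\<Sum>\<alpha>\<in>multi_indices l. a \<alpha> * monomial \<alpha> \<zeta>)}"

definition fock :: "(complex ^ 'd \<Rightarrow> complex) \<Rightarrow> (complex ^ 'd \<Rightarrow> complex) \<Rightarrow> complex" where
  "fock \<phi> \<psi> = (LINT \<omega>|lborel. exp (- cdot \<omega> \<omega>) / of_real pi ^ CARD('d) * cnj (\<phi> \<omega>) * \<psi> \<omega>)"


section \<open>Hilbert spaces of polynomial-valued holomorphic maps\<close>

text \<open>A map \<open>z \<mapsto> \<Phi>\<^sub>z\<close> is the curried function \<open>\<Phi> z \<zeta>\<close>. Maps are only meant on \<open>D\<close>; for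
  definiteness they are extended by zero.\<close>

type_synonym 'd polymap = "complex ^ 'd \<Rightarrow> complex ^ 'd \<Rightarrow> complex"

definition cscale :: "complex \<Rightarrow> ('d::finite) polymap \<Rightarrow> 'd polymap" where
  "cscale a \<Phi> = (\<lambda>z \<zeta>. a * \<Phi> z \<zeta>)"

lemma module_cscale: "module cscale"
  by unfold_locales (auto simp: cscale_def fun_eq_iff algebra_simps)

definition holomorphic_D :: "(complex ^ 'd \<Rightarrow> complex) \<Rightarrow> bool" where
  "holomorphic_D f \<longleftrightarrow>
    (\<forall>z\<in>D. \<exists>L. (f has_derivative L) (at z) \<and> (\<forall>c v. L (c *s v) = c * L v))"

text \<open>A map into the finite-dimensional space \<open>hom_polys l\<close> is holomorphic if its coordinates in
  the monomial basis are.\<close>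

definition hol_polymaps :: "nat \<Rightarrow> ('d::finite) polymap set" where
  "hol_polymaps l = {\<Phi>. (\<forall>z. z \<notin> D \<longrightarrow> \<Phi> z = 0) \<and>
     (\<exists>a. (\<forall>\<alpha>\<in>multi_indices l. holomorphic_D (a \<alpha>)) \<and>
          (\<forall>z\<in>D. \<forall>\<zeta>. \<Phi> z \<zeta> = (\<Sum>\<alpha>\<in>multi_indices l. a \<alpha> z * monomial \<alpha> \<zeta>)))}"

text \<open>As for \<open>fock\<close>, the inner product is conjugate-linear in its first argument.\<close>

locale polymap_hilbert_space =
  fixes H :: "('d::finite) polymap set" and ip :: "'d polymap \<Rightarrow> 'd polymap \<Rightarrow> complex"
  assumes subspace: "module.subspace cscale H"
    and ip_add: "\<lbrakk>f \<in> H; g \<in> H; h \<in> H\<rbrakk> \<Longrightarrow> ip f (g + h) = ip f g + ip f h"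
    and ip_scale: "\<lbrakk>f \<in> H; g \<in> H\<rbrakk> \<Longrightarrow> ip f (cscale a g) = a * ip f g"
    and ip_cnj: "\<lbrakk>f \<in> H; g \<in> H\<rbrakk> \<Longrightarrow> ip g f = cnj (ip f g)"
    and ip_nonneg: "f \<in> H \<Longrightarrow> 0 \<le> Re (ip f f)"
    and ip_definite: "\<lbrakk>f \<in> H; ip f f = 0\<rbrakk> \<Longrightarrow> f = 0"
    and complete: "Metric_space.mcomplete H (\<lambda>f g. sqrt (Re (ip (f - g) (f - g))))"

text \<open>The integral operator with kernel \<open>Knl \<nu> l z w\<close> with respect to the Fischer-Fock measure,
  applied to \<open>\<phi>\<close>, for fixed \<open>w\<close> and as a map of \<open>z\<close>.\<close>

definition kernel_map ::
  "real \<Rightarrow> nat \<Rightarrow> complex ^ 'd \<Rightarrow> (complex ^ 'd \<Rightarrow> complex) \<Rightarrow> ('d::finite) polymap" where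
  "kernel_map \<nu> l w \<phi> =
     (\<lambda>z \<zeta>. if z \<in> D then fock (\<lambda>\<omega>. cnj (Knl \<nu> l z w \<zeta> \<omega>)) \<phi> else 0)"

text \<open>The space \<open>H\<^sup>2\<^sub>\<nu>(D, hom_polys l)\<close>, which is determined uniquely by its reproducing kernel.\<close>

locale H2_space = polymap_hilbert_space H ip
  for \<nu> :: real and l :: nat
    and H :: "('d::finite) polymap set" and ip :: "'d polymap \<Rightarrow> 'd polymap \<Rightarrow> complex" +
  assumes holomorphic: "H \<subseteq> hol_polymaps l"
    and kernel_mem: "\<lbrakk>w \<in> D; \<phi> \<in> hom_polys l\<rbrakk> \<Longrightarrow> kernel_map \<nu> l w \<phi> \<in> H"
    and reproducing: "\<lbrakk>w \<in> D; \<phi> \<in> hom_polys l; \<Phi> \<in> H\<rbrakk>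
      \<Longrightarrow> ip (kernel_map \<nu> l w \<phi>) \<Phi> = fock \<phi> (\<Phi> w)"

definition orthonormal_basis ::
  "('d::finite) polymap set \<Rightarrow> ('d polymap \<Rightarrow> 'd polymap \<Rightarrow> complex) \<Rightarrow> 'd polymap set \<Rightarrow> bool" where
  "orthonormal_basis H ip B \<longleftrightarrow> B \<subseteq> H \<and>
     (\<forall>f\<in>B. \<forall>g\<in>B. ip f g = (if f = g then 1 else 0)) \<and>
     (\<forall>f\<in>H. \<forall>\<epsilon>>0. \<exists>g\<in>module.span cscale B. sqrt (Re (ip (f - g) (f - g))) < \<epsilon>)"


section \<open>The intertwiners and the covariant kernel\<close>

text \<open>If \<open>\<Phi> z \<zeta>\<close> is a finite sum of products \<open>f z * \<psi> \<zeta>\<close>, then the map below is the sum of the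
  products of \<open>\<psi> \<zeta>\<close> with the \<open>k\<close>-th derivative of \<open>f (z + t \<zeta>)\<close> at \<open>t = 0\<close>.\<close>

definition dir_deriv :: "nat \<Rightarrow> ('d::finite) polymap \<Rightarrow> 'd polymap" where
  "dir_deriv k \<Phi> = (\<lambda>z \<zeta>. (deriv ^^ k) (\<lambda>t. \<Phi> (z + t *s \<zeta>) \<zeta>) 0)"

definition intertwiner :: "nat \<Rightarrow> real \<Rightarrow> nat \<Rightarrow> ('d::finite) polymap \<Rightarrow> 'd polymap" where
  "intertwiner n \<nu> l \<Phi> = (\<lambda>z \<zeta>. \<Sum>k\<le>n - l.
     of_real (pochhammer (real l - real n) k / pochhammer (2 * real l + \<nu>) k) *
     (dir_deriv k \<Phi> z \<zeta> / fact k))"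

definition big_kernel ::
  "nat \<Rightarrow> real \<Rightarrow> (nat \<Rightarrow> real) \<Rightarrow> (nat \<Rightarrow> ('d::finite) polymap set) \<Rightarrow>
    complex ^ 'd \<Rightarrow> complex ^ 'd \<Rightarrow> complex ^ 'd \<Rightarrow> complex ^ 'd \<Rightarrow> complex" where
  "big_kernel n \<nu> c B z w \<zeta> \<omega> = (\<Sum>l\<le>n. of_real (c l) *
     (\<Sum>\<^sub>\<infinity>\<Phi>\<in>B l. intertwiner n \<nu> l \<Phi> z \<zeta> * cnj (intertwiner n \<nu> l \<Phi> w \<omega>)))"

text \<open>\<open>kappa n \<nu> l m\<close> is the coefficient with upper index \<open>l\<close> and lower index \<open>m\<close>; it is meant
  for \<open>l \<le> m \<le> n\<close>.\<close>

definition kappa :: "nat \<Rightarrow> real \<Rightarrow> nat \<Rightarrow> nat \<Rightarrow> real" where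
  "kappa n \<nu> l m =
     (pochhammer (real l - real n) (m - l) / pochhammer (\<nu> + 2 * real l) (m - l))\<^sup>2 *
     (\<Sum>(i, j) | i + j = m - l. ((\<nu> + real m - 1) gchoose i) * (real l gchoose j))"

end

theory Submission
  imports Defs "HOL-Complex_Analysis.Complex_Analysis" "HOL-Probability.Distributions"
begin

text \<open>Along the rays through \<open>\<zeta>\<close> and \<open>\<omega>\<close> the operator \<open>Bop (s *s \<zeta>) (t *s \<omega>)\<close> maps \<open>\<zeta>\<close> to
  \<open>\<Delta>\<^sup>2 *s \<zeta>\<close> with \<open>\<Delta> = 1 - s * cnj t * cdot \<zeta> \<omega>\<close>, so the reproducing kernel reduces to the scalar
  function \<open>cdot \<zeta> \<omega> ^ l / fact l * \<Delta> powr (- \<nu> - 2 * l)\<close>, whose binomial series has the coefficients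
  \<open>pochhammer (\<nu> + 2 * l) k / fact k\<close>. At the origin, the intertwiner is a combination of the Taylor
  coefficients of \<open>t \<mapsto> \<Phi> (t *s \<zeta>) \<zeta>\<close>. These are bounded functionals, being norm limits of
  combinations of evaluations, so Parseval's identity turns the sum over the orthonormal basis into
  the corresponding mixed Taylor coefficients of the kernel. Vandermonde's convolution identifies
  the result with \<open>kappa\<close>.

  Passing from the integral kernel to evaluations needs the reproducing property of the
  Fischer-Fock product, which comes down to the Gaussian moments of the monomials of one complex
  variable: the mixed ones vanish by rotation invariance (a rotation is a product of three shears),
  and for the others \<open>(norm z)\<^sup>2\<close> pushes Lebesgue measure forward to \<open>pi\<close> times Lebesgue measure on
  the half-line.\<close>


section \<open>Gaussian moments and the Fischer-Fock product\<close>

text \<open>Boxes determine Lebesgue measure, and \<open>Complex\<close> pulls a box back to a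
  product of two intervals.\<close>

lemma lborel_complex_eq_distr_Complex:
  "(lborel :: complex measure) = distr (lborel \<Otimes>\<^sub>M lborel) borel (\<lambda>(x, y). Complex x y)"
proof (rule lborel_eqI)
  have [measurable]: "(\<lambda>(x, y). Complex x y) \<in> borel \<rightarrow>\<^sub>M borel"
    unfolding Complex_eq case_prod_beta
    by (intro borel_measurable_continuous_onI continuous_intros)
  fix l u :: complex assume lu: "\<And>b. b \<in> Basis \<Longrightarrow> l \<bullet> b \<le> u \<bullet> b"
  have le: "Re l \<le> Re u" "Im l \<le> Im u"
    using lu[of 1] lu[of \<i>] by (auto simp: Basis_complex_def)
  have "(\<lambda>(x, y). Complex x y) -` box l u = {Re l<..<Re u} \<times> {Im l<..<Im u}"
    by (auto simp: in_box_complex_iff)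
  then show "emeasure (distr (lborel \<Otimes>\<^sub>M lborel) borel (\<lambda>(x, y). Complex x y)) (box l u)
      = (\<Prod>b\<in>Basis. (u - l) \<bullet> b)"
    using le by (simp add: emeasure_distr lborel_prod space_lborel Basis_complex_def
        flip: ennreal_mult)
      (simp add: lborel.emeasure_pair_measure_Times ennreal_mult flip: lborel_prod)
qed simp

text \<open>Each shear below needs the coordinate that it moves as the inner variable, hence both
  orders of integration.\<close>

lemma nn_integral_lborel_complex:
  assumes [measurable]: "f \<in> borel_measurable borel"
  shows "(\<integral>\<^sup>+z. f z \<partial>lborel) = (\<integral>\<^sup>+y. \<integral>\<^sup>+x. f (Complex x y) \<partial>lborel \<partial>lborel)"
    and "(\<integral>\<^sup>+z. f z \<partial>lborel) = (\<integral>\<^sup>+x. \<integral>\<^sup>+y. f (Complex x y) \<partial>lborel \<partial>lborel)"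
proof -
  have "(\<lambda>(x, y). Complex x y) \<in> borel \<rightarrow>\<^sub>M borel"
    unfolding Complex_eq case_prod_beta
    by (intro borel_measurable_continuous_onI continuous_intros)
  then have [measurable]: "(\<lambda>(x, y). Complex x y) \<in> lborel \<Otimes>\<^sub>M lborel \<rightarrow>\<^sub>M borel"
    by (simp add: lborel_prod)
  have *: "(\<integral>\<^sup>+z. f z \<partial>lborel) = (\<integral>\<^sup>+p. f (case p of (x, y) \<Rightarrow> Complex x y) \<partial>(lborel \<Otimes>\<^sub>M lborel))"
    by (subst lborel_complex_eq_distr_Complex) (simp add: nn_integral_distr)
  show "(\<integral>\<^sup>+z. f z \<partial>lborel) = (\<integral>\<^sup>+y. \<integral>\<^sup>+x. f (Complex x y) \<partial>lborel \<partial>lborel)"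
    unfolding * by (subst lborel_pair.nn_integral_snd[symmetric]) auto
  show "(\<integral>\<^sup>+z. f z \<partial>lborel) = (\<integral>\<^sup>+x. \<integral>\<^sup>+y. f (Complex x y) \<partial>lborel \<partial>lborel)"
    unfolding * by (subst lborel.nn_integral_fst[symmetric]) auto
qed

text \<open>With one coordinate held fixed, a shear translates the other one, so translation
  invariance of the inner real integral suffices.\<close>

lemma distr_lborel_complex_shear:
  fixes a :: real
  shows "distr lborel borel (\<lambda>z. z + of_real (a * Im z)) = lborel"
    and "distr lborel borel (\<lambda>z. z + \<i> * of_real (a * Re z)) = lborel"
proof -
  have trans: "(\<integral>\<^sup>+x. f (t + x) \<partial>lborel) = (\<integral>\<^sup>+x. f x \<partial>lborel)"
    if "f \<in> borel_measurable borel" for f :: "real \<Rightarrow> ennreal" and t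
    using nn_integral_real_affine[OF that, of 1 t] by simp
  have [measurable]: "(\<lambda>x. Complex x y) \<in> borel_measurable borel" 
      "(\<lambda>x. Complex y x) \<in> borel_measurable borel" for y
    unfolding Complex_eq by (intro borel_measurable_continuous_onI continuous_intros)+
  show "distr lborel borel (\<lambda>z. z + of_real (a * Im z)) = lborel"
  proof (rule measure_eqI)
    fix A assume "A \<in> sets (distr lborel borel (\<lambda>z. z + of_real (a * Im z)))"
    then have [measurable]: "A \<in> sets borel" by simp
    have "emeasure (distr lborel borel (\<lambda>z. z + of_real (a * Im z))) A
        = (\<integral>\<^sup>+z. indicator A (z + of_real (a * Im z)) \<partial>lborel)"
      by (simp add: nn_integral_distr flip: nn_integral_indicator)
    also have "\<dots> = (\<integral>\<^sup>+y. \<integral>\<^sup>+x. indicator A (Complex (a * y + x) y) \<partial>lborel \<partial>lborel)"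
      by (subst nn_integral_lborel_complex(1), measurable)
         (intro nn_integral_cong arg_cong[where f = "indicator A"], simp add: complex_eq_iff)
    also have "\<dots> = (\<integral>\<^sup>+y. \<integral>\<^sup>+x. indicator A (Complex x y) \<partial>lborel \<partial>lborel)"
      by (intro nn_integral_cong trans) measurable
    also have "\<dots> = emeasure lborel A"
      by (subst nn_integral_lborel_complex(1)[symmetric]) auto
    finally show "emeasure (distr lborel borel (\<lambda>z. z + of_real (a * Im z))) A = emeasure lborel A" .
  qed simp
  show "distr lborel borel (\<lambda>z. z + \<i> * of_real (a * Re z)) = lborel"
  proof (rule measure_eqI)
    fix A assume "A \<in> sets (distr lborel borel (\<lambda>z. z + \<i> * of_real (a * Re z)))"
    then have [measurable]: "A \<in> sets borel" by simp
    have "emeasure (distr lborel borel (\<lambda>z. z + \<i> * of_real (a * Re z))) A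
        = (\<integral>\<^sup>+z. indicator A (z + \<i> * of_real (a * Re z)) \<partial>lborel)"
      by (simp add: nn_integral_distr flip: nn_integral_indicator)
    also have "\<dots> = (\<integral>\<^sup>+x. \<integral>\<^sup>+y. indicator A (Complex x (a * x + y)) \<partial>lborel \<partial>lborel)"
      by (subst nn_integral_lborel_complex(2), measurable)
         (intro nn_integral_cong arg_cong[where f = "indicator A"], simp add: complex_eq_iff)
    also have "\<dots> = (\<integral>\<^sup>+x. \<integral>\<^sup>+y. indicator A (Complex x y) \<partial>lborel \<partial>lborel)"
      by (intro nn_integral_cong trans) measurable
    also have "\<dots> = emeasure lborel A"
      by (subst nn_integral_lborel_complex(2)[symmetric]) auto
    finally show "emeasure (distr lborel borel (\<lambda>z. z + \<i> * of_real (a * Re z))) A = emeasure lborel A" .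
  qed simp
qed

lemma distr_lborel_complex_rotation:
  fixes u :: complex
  assumes u: "norm u = 1" "Im u \<noteq> 0"
  shows "distr lborel borel (\<lambda>z. u * z) = lborel"
proof -
  \<comment> \<open>If \<open>u\<close> has argument \<theta>, this is minus the tangent of
    \<theta>/2, the factor of the outer shears in the factorization of a rotation as
    \<open>S\<close>, \<open>T\<close>, \<open>S\<close>. The quotient is why \<open>Im u\<close>
    must not vanish.\<close>
  define a where "a = (Re u - 1) / Im u"
  define S where "S = (\<lambda>z. z + complex_of_real (a * Im z))"
  define T where "T = (\<lambda>z. z + \<i> * complex_of_real (Im u * Re z))"
  have [measurable]: "S \<in> borel_measurable borel" "T \<in> borel_measurable borel"
    unfolding S_def T_def by measurable
  have uu: "Re u ^ 2 + Im u ^ 2 = 1"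
    using u(1) by (metis cmod_power2 one_power2)
  have a: "1 + a * Im u = Re u" "a * (1 + Re u) = - Im u"
    using u(2) uu by (auto simp: a_def field_simps power2_eq_square)
  have "S (T (S z)) = u * z" for z
  proof (rule complex_eqI)
    have "Re (S (T (S z))) = (1 + a * Im u) * Re z + (a * (1 + (1 + a * Im u))) * Im z"
      by (simp add: S_def T_def algebra_simps)
    also have "\<dots> = Re (u * z)"
      by (simp only: a) simp
    finally show "Re (S (T (S z))) = Re (u * z)" .
    have "Im (S (T (S z))) = Im u * Re z + (1 + a * Im u) * Im z"
      by (simp add: S_def T_def algebra_simps)
    also have "\<dots> = Im (u * z)"
      by (simp only: a) simp
    finally show "Im (S (T (S z))) = Im (u * z)" .
  qed
  then have "distr lborel borel (\<lambda>z. u * z) = distr lborel borel (\<lambda>z. S (T (S z)))"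
    by presburger
  also have "\<dots> = distr (distr (distr lborel borel S) borel T) borel S"
    by (simp add: distr_distr comp_def)
  also have "\<dots> = lborel"
    unfolding S_def T_def by (simp only: distr_lborel_complex_shear)
  finally show ?thesis .
qed

text \<open>The half-lines \<open>{..a}\<close> are stable under intersection and generate the Borel
  sets. Their preimages are discs of radius \<open>sqrt a\<close>, of area \<open>pi * a\<close>, or
  empty for negative \<open>a\<close>, which accounts for \<open>max 0 a\<close> in the
  proof.\<close>

lemma distr_lborel_complex_norm_square:
  "distr lborel borel (\<lambda>z::complex. (norm z)\<^sup>2)
     = density lborel (\<lambda>t::real. ennreal pi * indicator {0..} t)"
proof (rule measure_eqI_generator_eq[where E = "range (\<lambda>a::real. {..a})" and \<Omega> = UNIV
        and A = "\<lambda>i. {..real i}"])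
  show "Int_stable (range (\<lambda>a::real. {..a}))"
    by (auto simp: Int_stable_def)
  have em: "emeasure (distr lborel borel (\<lambda>z::complex. (norm z)\<^sup>2)) {..a} = ennreal pi * max 0 a"
    for a :: real
  proof (cases "a \<ge> 0")
    case True
    have "(\<lambda>z::complex. (norm z)\<^sup>2) -` {..a} = cball 0 (sqrt a)"
      using True by (auto simp: real_le_rsqrt intro!: sqrt_ge_absD)
    then show ?thesis
      using True by (simp add: emeasure_distr emeasure_cball unit_ball_vol_2 ennreal_mult max_def)
  next
    case False
    have "(\<lambda>z::complex. (norm z)\<^sup>2) -` {..a} = {}"
      using False by auto (smt (verit) zero_le_power2)
    then show ?thesis
      using False by (simp add: emeasure_distr max_def)
  qed
  show "emeasure (distr lborel borel (\<lambda>z::complex. (norm z)\<^sup>2)) X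
      = emeasure (density lborel (\<lambda>t. ennreal pi * indicator {0..} t)) X"
    if X: "X \<in> range (\<lambda>a::real. {..a})" for X
  proof -
    obtain a where a: "X = {..a}" using X by auto
    have "emeasure (density lborel (\<lambda>t. ennreal pi * indicator {0..} t)) X
        = (\<integral>\<^sup>+t. ennreal pi * indicator {0..a} t \<partial>lborel)"
      unfolding a by (subst emeasure_density) (auto intro!: nn_integral_cong simp: indicator_def)
    also have "\<dots> = ennreal pi * max 0 a"
      by (subst nn_integral_cmult) (auto simp: max_def)
    finally show ?thesis by (simp add: em a)
  qed
  show "emeasure (distr lborel borel (\<lambda>z::complex. (norm z)\<^sup>2)) {..real i} \<noteq> \<infinity>" for i
    by (simp only: em) (simp flip: ennreal_mult)
  show "(\<Union>i. {..real i}) = UNIV"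
    using real_arch_simple by auto
qed (auto simp: borel_eq_atMost)

section \<open>Gaussian moments in one complex variable\<close>

text \<open>One-variable integrand of the Fischer-Fock product of \<open>z ^ a\<close> and
  \<open>z ^ b\<close>, without the factor \<open>1 / pi\<close>. The exponent is kept complex to
  match \<open>cdot\<close>.\<close>

definition gauss_moment :: "nat \<Rightarrow> nat \<Rightarrow> complex \<Rightarrow> complex" where
  "gauss_moment a b z = exp (- (z * cnj z)) * cnj z ^ a * z ^ b"

lemma borel_measurable_gauss_moment [measurable]: "gauss_moment a b \<in> borel_measurable borel"
  unfolding gauss_moment_def
  by (intro borel_measurable_continuous_onI continuous_intros)

lemma norm_gauss_moment: "norm (gauss_moment a b z) = exp (- (norm z)\<^sup>2) * norm z ^ (a + b)"
proof -
  have "z * cnj z = of_real ((norm z)\<^sup>2)"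
    by (metis complex_norm_square)
  then show ?thesis
    by (simp add: gauss_moment_def norm_mult norm_power norm_exp_eq_Re power_add flip: of_real_power)
qed

text \<open>In the variable \<open>t = (norm z)\<^sup>2\<close> the integral becomes
  \<open>pi\<close> times the Gamma integral of \<open>t ^ k * exp (- t)\<close>.\<close>

lemma nn_integral_gauss_moment:
  "(\<integral>\<^sup>+(z::complex). ennreal (exp (- (norm z)\<^sup>2) * (norm z)\<^sup>2 ^ k) \<partial>lborel) = ennreal (pi * fact k)"
proof -
  have "(\<integral>\<^sup>+(z::complex). ennreal (exp (- (norm z)\<^sup>2) * (norm z)\<^sup>2 ^ k) \<partial>lborel)
     = (\<integral>\<^sup>+t. ennreal (exp (- t) * t ^ k) \<partial>distr lborel borel (\<lambda>z::complex. (norm z)\<^sup>2))"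
    by (simp add: nn_integral_distr)
  also have "\<dots> = (\<integral>\<^sup>+t. ennreal pi * (ennreal (t ^ k * exp (- t)) * indicator {0..} t) \<partial>lborel)"
    unfolding distr_lborel_complex_norm_square
    by (subst nn_integral_density) (auto intro!: nn_integral_cong simp: mult_ac)
  also have "\<dots> = ennreal pi * (\<integral>\<^sup>+t. ennreal (t ^ k * exp (- t)) * indicator {0..} t \<partial>lborel)"
    by (rule nn_integral_cmult) auto
  also have "\<dots> = ennreal (pi * fact k)"
    by (subst nn_intergal_power_times_exp_Ici) (simp flip: ennreal_mult)
  finally show ?thesis .
qed

text \<open>Only even powers of the norm have been integrated. An arbitrary power is at most
  \<open>1\<close> on the unit disc and at most its own square elsewhere, so two even moments
  provide a majorant.\<close>

lemma integrable_gauss_moment: "integrable lborel (gauss_moment a b)"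
proof (rule Bochner_Integration.integrable_bound)
  show "integrable lborel (\<lambda>z::complex. exp (- (norm z)\<^sup>2) * (norm z)\<^sup>2 ^ 0
      + exp (- (norm z)\<^sup>2) * (norm z)\<^sup>2 ^ (a + b))"
    by (intro Bochner_Integration.integrable_add integrableI_nonneg; 
        (subst nn_integral_gauss_moment)?; simp)
  have "norm z ^ (a + b) \<le> 1 + (norm z)\<^sup>2 ^ (a + b)" for z :: complex
  proof (cases "norm z \<le> 1")
    case True
    then show ?thesis by (simp add: power_le_one add_increasing2)
  next
    case False
    then have "norm z ^ (a + b) \<le> (norm z ^ 2) ^ (a + b)"
      by (intro power_mono self_le_power) auto
    then show ?thesis by simp
  qed
  then have "norm (gauss_moment a b z) \<le> exp (- (norm z)\<^sup>2) * (1 + (norm z)\<^sup>2 ^ (a + b))" for z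
    unfolding norm_gauss_moment by (intro mult_left_mono) auto
  then show "AE z in lborel. norm (gauss_moment a b z)
      \<le> norm (exp (- (norm z)\<^sup>2) * (norm z)\<^sup>2 ^ 0 + exp (- (norm z)\<^sup>2) * (norm z)\<^sup>2 ^ (a + b))"
    by (simp add: distrib_left)
qed simp

lemma integral_gauss_moment_diag: "(\<integral>z. gauss_moment a a z \<partial>lborel) = of_real (pi * fact a)"
proof -
  have "gauss_moment a a z = of_real (exp (- (norm z)\<^sup>2) * (norm z)\<^sup>2 ^ a)" for z
  proof -
    have "z * cnj z = of_real ((norm z)\<^sup>2)"
      by (metis complex_norm_square)
    moreover have "gauss_moment a a z = exp (- (z * cnj z)) * (z * cnj z) ^ a"
      by (simp add: gauss_moment_def power_mult_distrib mult_ac)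
    ultimately show ?thesis 
      by (simp add: exp_of_real flip: of_real_minus of_real_power)
  qed
  moreover have "(\<integral>(z::complex). exp (- (norm z)\<^sup>2) * (norm z)\<^sup>2 ^ a \<partial>lborel) = pi * fact a"
    by (rule integral_eq_nn_integral[THEN trans]) (simp_all add: nn_integral_gauss_moment)
  ultimately show ?thesis
    by (simp only: integral_complex_of_real)
qed

text \<open>Rotation by a \<open>2 * (b - a)\<close>-th root of \<open>-1\<close> multiplies the integrand by \<open>\<i>\<close>.\<close>

lemma integral_gauss_moment_less:
  assumes "a < b"
  shows "(\<integral>z. gauss_moment a b z \<partial>lborel) = 0"
proof -
  define k where "k = b - a"
  have k: "k > 0" "b = a + k" using assms by (auto simp: k_def)
  define u where "u = cis (pi / (2 * real k))"
  have uk: "u ^ k = \<i>"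
  proof -
    have "real k * (pi / (2 * real k)) = pi / 2"
      using k by simp
    then show ?thesis by (simp only: u_def Complex.DeMoivre cis_pi_half)
  qed
  have nu: "norm u = 1" by (simp add: u_def)
  \<comment> \<open>The angle is positive and at most \<open>pi / 2\<close>, so \<open>u\<close> is
    not real and the rotation lemma applies.\<close>
  have "sin (pi / (2 * real k)) > 0"
    using k by (intro sin_gt_zero) (auto simp: field_simps intro: less_le_trans[of _ "pi * 2"])
  then have im: "Im u \<noteq> 0" by (simp add: u_def)
  have uu: "u * cnj u = 1"
    using complex_norm_square[of u] nu by simp
  have "gauss_moment a b (u * z) = \<i> * gauss_moment a b z" for z
  proof -
    have "gauss_moment a b (u * z)
        = exp (- ((u * cnj u) * (z * cnj z))) * (u * cnj u) ^ a * u ^ k * cnj z ^ a * z ^ b"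
      by (simp add: gauss_moment_def power_mult_distrib k(2) power_add mult_ac)
    then show ?thesis
      by (simp add: uu uk gauss_moment_def)
  qed
  moreover have "(\<integral>z. gauss_moment a b z \<partial>lborel) = (\<integral>z. gauss_moment a b (u * z) \<partial>lborel)"
    by (subst distr_lborel_complex_rotation[OF nu im, symmetric]) (simp add: integral_distr)
  ultimately have "(\<integral>z. gauss_moment a b z \<partial>lborel) = \<i> * (\<integral>z. gauss_moment a b z \<partial>lborel)"
    by simp
  then show ?thesis
    by (metis complex_i_not_one mult_cancel_right1)
qed

lemma integral_gauss_moment:
  "(\<integral>z. gauss_moment a b z \<partial>lborel) = (if a = b then of_real (pi * fact a) else 0)"
proof -
  have "(\<integral>z. gauss_moment a b z \<partial>lborel) = 0" if "b < a"
  proof -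
    have "gauss_moment a b z = cnj (gauss_moment b a z)" for z
      by (simp add: gauss_moment_def exp_cnj mult_ac)
    then have "(\<integral>z. gauss_moment a b z \<partial>lborel) = cnj (\<integral>z. gauss_moment b a z \<partial>lborel)"
      by simp
    then show ?thesis using that by (simp add: integral_gauss_moment_less)
  qed
  then show ?thesis
    using integral_gauss_moment_less[of a b] by (auto simp: integral_gauss_moment_diag neq_iff)
qed

section \<open>Lebesgue measure on complex vectors as a product measure\<close>

lemma box_vec_complex_iff:
  fixes l u :: "complex ^ 'd"
  shows "x \<in> box l u \<longleftrightarrow> (\<forall>i. x $ i \<in> box (l $ i) (u $ i))"
  by (auto simp: mem_box Basis_vec_def inner_axis)

lemma prod_Basis_vec:
  fixes f :: "'a::euclidean_space ^ 'd \<Rightarrow> 'b::comm_monoid_mult"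
  shows "(\<Prod>b\<in>Basis. f b) = (\<Prod>i\<in>UNIV. \<Prod>b\<in>Basis. f (axis i b))"
proof -
  have inj: "inj_on (\<lambda>(i, b). axis i b :: 'a ^ 'd) (UNIV \<times> Basis)"
    by (auto simp: inj_on_def axis_eq_axis nonzero_Basis)
  have "Basis = (\<lambda>(i, b). axis i b :: 'a ^ 'd) ` (UNIV \<times> Basis)"
    by (auto simp: Basis_vec_def)
  then have "(\<Prod>b\<in>Basis. f b) = (\<Prod>p\<in>UNIV \<times> Basis. f (case p of (i, b) \<Rightarrow> axis i b))"
    using prod.reindex[OF inj, of f] by (simp add: comp_def)
  then show ?thesis
    by (simp add: prod.cartesian_product case_prod_beta)
qed

lemma measurable_vec_lambda:
  "(\<lambda>f. \<chi> i. f i) \<in> PiM UNIV (\<lambda>_::'d::finite. lborel :: 'a::euclidean_space measure) \<rightarrow>\<^sub>M borel"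
proof (subst borel_measurable_euclidean_space, rule ballI)
  fix b :: "'a ^ 'd" assume "b \<in> Basis"
  then obtain i c where "b = axis i c" by (auto simp: Basis_vec_def)
  then have "(\<lambda>f. (\<chi> i. f i) \<bullet> b) = (\<lambda>f. f i \<bullet> c)"
    by (simp add: inner_axis)
  moreover have "(\<lambda>f. f i \<bullet> c) \<in> borel_measurable (PiM UNIV (\<lambda>_::'d. lborel :: 'a measure))"
    by measurable
  ultimately show "(\<lambda>f. (\<chi> i. f i) \<bullet> b) \<in> borel_measurable (PiM UNIV (\<lambda>_::'d. lborel :: 'a measure))"
    by simp
qed

text \<open>Again a comparison on boxes: a box of vectors is the product of its coordinate boxes,
  and its volume factors accordingly.\<close>

lemma lborel_vec_eq_distr_PiM:
  "(lborel :: (complex ^ 'd) measure) = distr (PiM UNIV (\<lambda>_. lborel)) borel (\<lambda>f. \<chi> i. f i)"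
proof (rule lborel_eqI)
  interpret product_sigma_finite "\<lambda>_::'d. lborel :: complex measure" ..
  fix l u :: "complex ^ 'd" assume lu: "\<And>b. b \<in> Basis \<Longrightarrow> l \<bullet> b \<le> u \<bullet> b"
  have le: "l $ i \<bullet> b \<le> u $ i \<bullet> b" if "b \<in> Basis" for i b
    using lu[of "axis i b"] that by (simp add: inner_axis)
  have vi: "(\<lambda>f. \<chi> i. f i) -` box l u = PiE UNIV (\<lambda>i. box (l $ i) (u $ i))"
    by (auto simp: box_vec_complex_iff PiE_iff)
  show "emeasure (distr (PiM UNIV (\<lambda>_. lborel)) borel (\<lambda>f. \<chi> i. f i)) (box l u) = (\<Prod>b\<in>Basis. (u - l) \<bullet> b)"
    using le by (simp add: emeasure_distr measurable_vec_lambda vi space_PiM space_lborel emeasure_PiM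
        emeasure_lborel_box prod_Basis_vec inner_axis prod_ennreal prod_nonneg inner_diff_left)
qed simp

text \<open>Fubini's theorem for products of one-variable functions, which reduces Fischer-Fock
  integrals of monomials to \<open>gauss_moment\<close>.\<close>

lemma
  fixes f :: "'d::finite \<Rightarrow> complex \<Rightarrow> complex"
  assumes "\<And>i. integrable lborel (f i)"
  shows integrable_lborel_vec_prod: "integrable lborel (\<lambda>\<omega>::complex ^ 'd. \<Prod>i\<in>UNIV. f i (\<omega> $ i))"
    and integral_lborel_vec_prod:
      "(\<integral>\<omega>. (\<Prod>i\<in>UNIV. f i (\<omega> $ i)) \<partial>lborel) = (\<Prod>i\<in>UNIV. \<integral>z. f i z \<partial>lborel)"
proof -
  interpret product_sigma_finite "\<lambda>_::'d. lborel :: complex measure" ..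
  have [measurable]: "f i \<in> borel_measurable borel" for i
    using borel_measurable_integrable[OF assms, of i] by simp
  have m: "(\<lambda>\<omega>::complex ^ 'd. \<Prod>i\<in>UNIV. f i (\<omega> $ i)) \<in> borel_measurable borel"
  proof (rule borel_measurable_prod)
    fix i :: 'd
    have [measurable]: "(\<lambda>\<omega>::complex ^ 'd. \<omega> $ i) \<in> borel_measurable borel"
      by (intro borel_measurable_continuous_onI continuous_intros)
    show "(\<lambda>\<omega>::complex ^ 'd. f i (\<omega> $ i)) \<in> borel_measurable borel"
      by measurable
  qed
  show "integrable lborel (\<lambda>\<omega>::complex ^ 'd. \<Prod>i\<in>UNIV. f i (\<omega> $ i))"
    using product_integrable_prod[of UNIV f] assms
    by (simp add: lborel_vec_eq_distr_PiM integrable_distr_eq[OF measurable_vec_lambda m])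
  show "(\<integral>\<omega>. (\<Prod>i\<in>UNIV. f i (\<omega> $ i)) \<partial>lborel) = (\<Prod>i\<in>UNIV. \<integral>z. f i z \<partial>lborel)"
    using product_integral_prod[of UNIV f] assms
    by (simp add: lborel_vec_eq_distr_PiM integral_distr[OF measurable_vec_lambda m])
qed

section \<open>Orthogonality of the monomials\<close>

text \<open>The exponent is a sum over the coordinates and \<open>pi\<close> occurs once per
  coordinate, so the integrand factors.\<close>

lemma fock_integrand_monomial:
  fixes \<omega> :: "complex ^ 'd"
  shows "exp (- cdot \<omega> \<omega>) / of_real pi ^ CARD('d) * cnj (monomial \<alpha> \<omega>) * monomial \<beta> \<omega>
    = (\<Prod>i\<in>UNIV. gauss_moment (\<alpha> i) (\<beta> i) (\<omega> $ i) / of_real pi)"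
  by (simp add: cdot_def monomial_def gauss_moment_def exp_sum prod.distrib prod_dividef
      flip: sum_negf)

lemma integrable_fock_monomial:
  "integrable lborel (\<lambda>\<omega> :: complex ^ 'd.
     exp (- cdot \<omega> \<omega>) / of_real pi ^ CARD('d) * cnj (monomial \<alpha> \<omega>) * monomial \<beta> \<omega>)"
  unfolding fock_integrand_monomial
  by (rule integrable_lborel_vec_prod) (simp add: integrable_gauss_moment)

lemma fock_monomial:
  fixes \<alpha> \<beta> :: "'d::finite \<Rightarrow> nat"
  shows "fock (monomial \<alpha>) (monomial \<beta>) = (if \<alpha> = \<beta> then \<Prod>i\<in>UNIV. fact (\<alpha> i) else 0)"
proof -
  have "fock (monomial \<alpha>) (monomial \<beta>)
      = (\<Prod>i\<in>UNIV. \<integral>z. gauss_moment (\<alpha> i) (\<beta> i) z / of_real pi \<partial>lborel)"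
    unfolding fock_def fock_integrand_monomial
    by (rule integral_lborel_vec_prod) (simp add: integrable_gauss_moment)
  also have "\<dots> = (\<Prod>i\<in>UNIV. if \<alpha> i = \<beta> i then fact (\<alpha> i) else 0)"
    by (intro prod.cong) (simp_all add: integral_gauss_moment)
  also have "\<dots> = (if \<alpha> = \<beta> then \<Prod>i\<in>UNIV. fact (\<alpha> i) else 0)"
    by (auto simp: fun_eq_iff intro!: prod_zero)
  finally show ?thesis .
qed

section \<open>Multinomial expansion of \<open>Ekernel\<close> and its reproducing property\<close>

lemma finite_multi_indices [simp]: "finite (multi_indices l :: ('d::finite \<Rightarrow> nat) set)"
proof (rule finite_subset)
  show "multi_indices l \<subseteq> (PiE UNIV (\<lambda>_. {..l}) :: ('d \<Rightarrow> nat) set)"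
    by (auto simp: multi_indices_def PiE_iff intro!: member_le_sum)
qed (simp add: finite_PiE)

text \<open>Induction step for the multinomial theorem: the exponent \<open>k\<close> at
  \<open>x\<close> is split off. Indices are functions on the whole type that vanish off the finite
  set, which makes the splitting invertible.\<close>

lemma bij_betw_multi_indices_fun_upd:
  fixes F :: "'d::finite set"
  assumes "x \<notin> F"
  shows "bij_betw (\<lambda>(k, \<alpha>). \<alpha>(x := k)) (SIGMA k:{..l}. {\<alpha>. (\<Sum>i\<in>F. \<alpha> i) = l - k \<and> (\<forall>i. i \<notin> F \<longrightarrow> \<alpha> i = 0)})
    {\<alpha>. (\<Sum>i\<in>insert x F. \<alpha> i) = l \<and> (\<forall>i. i \<notin> insert x F \<longrightarrow> \<alpha> i = (0::nat))}"
proof (rule bij_betw_byWitness[where f' = "\<lambda>\<alpha>. (\<alpha> x, \<alpha>(x := 0))"])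
  have [simp]: "sum (\<alpha>(x := k)) F = sum \<alpha> F" "(\<Sum>i\<in>F. if i = x then k else \<alpha> i) = sum \<alpha> F"
    for \<alpha> :: "'d \<Rightarrow> nat" and k
    using assms by (auto intro!: sum.cong)
  show "\<forall>p\<in>SIGMA k:{..l}. {\<alpha>. (\<Sum>i\<in>F. \<alpha> i) = l - k \<and> (\<forall>i. i \<notin> F \<longrightarrow> \<alpha> i = 0)}.
      (\<lambda>\<alpha>. (\<alpha> x, \<alpha>(x := 0))) (case p of (k, \<alpha>) \<Rightarrow> \<alpha>(x := k)) = p"
    using assms by (auto simp: fun_eq_iff)
  show "(\<lambda>(k, \<alpha>). \<alpha>(x := k)) ` (SIGMA k:{..l}. {\<alpha>. (\<Sum>i\<in>F. \<alpha> i) = l - k \<and> (\<forall>i. i \<notin> F \<longrightarrow> \<alpha> i = 0)})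
      \<subseteq> {\<alpha>. (\<Sum>i\<in>insert x F. \<alpha> i) = l \<and> (\<forall>i. i \<notin> insert x F \<longrightarrow> \<alpha> i = 0)}"
    using assms by (auto simp: sum.insert_if)
  show "(\<lambda>\<alpha>. (\<alpha> x, \<alpha>(x := 0))) ` {\<alpha>. (\<Sum>i\<in>insert x F. \<alpha> i) = l \<and> (\<forall>i. i \<notin> insert x F \<longrightarrow> \<alpha> i = 0)}
      \<subseteq> (SIGMA k:{..l}. {\<alpha>. (\<Sum>i\<in>F. \<alpha> i) = l - k \<and> (\<forall>i. i \<notin> F \<longrightarrow> \<alpha> i = 0)})"
    using assms by (auto simp: sum.insert_if)
qed auto

text \<open>With divided powers \<open>x ^ k / fact k\<close> the binomial theorem is a plain
  convolution, so the induction over \<open>F\<close> carries no multinomial coefficients.\<close>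

lemma multinomial_divided_power:
  fixes x :: "'d::finite \<Rightarrow> complex"
  shows "(\<Sum>i\<in>F. x i) ^ l / fact l
    = (\<Sum>\<alpha> | (\<Sum>i\<in>F. \<alpha> i) = l \<and> (\<forall>i. i \<notin> F \<longrightarrow> \<alpha> i = 0). \<Prod>i\<in>F. x i ^ \<alpha> i / fact (\<alpha> i))"
  using finite[of F]
proof (induction F arbitrary: l rule: finite_induct)
  case empty
  have "{\<alpha> :: 'd \<Rightarrow> nat. 0 = l \<and> (\<forall>i. \<alpha> i = 0)} = (if l = 0 then {\<lambda>_. 0} else {})"
    by auto
  then show ?case by (auto simp: power_0_left)
next
  case (insert a F)
  let ?A = "\<lambda>F l. {\<alpha> :: 'd \<Rightarrow> nat. (\<Sum>i\<in>F. \<alpha> i) = l \<and> (\<forall>i. i \<notin> F \<longrightarrow> \<alpha> i = 0)}"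
  have fin: "finite (?A F m)" for m
  proof (rule finite_subset)
    show "?A F m \<subseteq> (\<Union>k\<le>m. multi_indices k)"
      by (auto simp: multi_indices_def intro!: sum_mono2 sum.mono_neutral_right)
  qed auto
  have "(x a + (\<Sum>i\<in>F. x i)) ^ l / fact l
      = (\<Sum>k\<le>l. x a ^ k / fact k * ((\<Sum>i\<in>F. x i) ^ (l - k) / fact (l - k)))"
    by (simp add: binomial_ring sum_divide_distrib binomial_fact mult_ac)
  also have "\<dots> = (\<Sum>k\<le>l. \<Sum>\<alpha>\<in>?A F (l - k). x a ^ k / fact k * (\<Prod>i\<in>F. x i ^ \<alpha> i / fact (\<alpha> i)))"
    by (simp add: insert.IH sum_distrib_left)
  also have "\<dots> = (\<Sum>(k, \<alpha>)\<in>(SIGMA k:{..l}. ?A F (l - k)).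
      x a ^ k / fact k * (\<Prod>i\<in>F. x i ^ \<alpha> i / fact (\<alpha> i)))"
    by (rule sum.Sigma) (auto intro: fin)
  also have "\<dots> = (\<Sum>(k, \<alpha>)\<in>(SIGMA k:{..l}. ?A F (l - k)).
      \<Prod>i\<in>insert a F. x i ^ (\<alpha>(a := k)) i / fact ((\<alpha>(a := k)) i))"
  proof (rule sum.cong, simp, clarify)
    fix k and \<alpha> :: "'d \<Rightarrow> nat"
    have "(\<Prod>i\<in>F. x i ^ (\<alpha>(a := k)) i / fact ((\<alpha>(a := k)) i)) = (\<Prod>i\<in>F. x i ^ \<alpha> i / fact (\<alpha> i))"
      using insert.hyps by (intro prod.cong) auto
    then show "x a ^ k / fact k * (\<Prod>i\<in>F. x i ^ \<alpha> i / fact (\<alpha> i))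
        = (\<Prod>i\<in>insert a F. x i ^ (\<alpha>(a := k)) i / fact ((\<alpha>(a := k)) i))"
      using insert.hyps by simp
  qed
  also have "\<dots> = (\<Sum>\<alpha>\<in>?A (insert a F) l. \<Prod>i\<in>insert a F. x i ^ \<alpha> i / fact (\<alpha> i))"
    using sum.reindex_bij_betw[OF bij_betw_multi_indices_fun_upd[OF insert.hyps(2), of l],
        of "\<lambda>\<alpha>. \<Prod>i\<in>insert a F. x i ^ \<alpha> i / fact (\<alpha> i)"]
    by (simp add: case_prod_beta')
  finally show ?case
    using insert.hyps by simp
qed

text \<open>The multinomial theorem for \<open>cdot \<zeta> \<omega>\<close>. The denominators are
  the squared norms found in \<open>fock_monomial\<close>, so this is the expansion of a reproducing
  kernel in an orthogonal basis.\<close>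

lemma Ekernel_eq_sum_monomial:
  "Ekernel l \<zeta> \<omega> = (\<Sum>\<alpha>\<in>multi_indices l.
     cnj (monomial \<alpha> \<omega>) / (\<Prod>i\<in>UNIV. fact (\<alpha> i)) * monomial \<alpha> \<zeta>)"
proof -
  have "Ekernel l \<zeta> \<omega> = (\<Sum>\<alpha>\<in>multi_indices l. \<Prod>i\<in>UNIV. (\<zeta> $ i * cnj (\<omega> $ i)) ^ \<alpha> i / fact (\<alpha> i))"
    using multinomial_divided_power[of "\<lambda>i. \<zeta> $ i * cnj (\<omega> $ i)" UNIV l]
    by (simp add: Ekernel_def cdot_def multi_indices_def)
  then show ?thesis
    by (simp add: monomial_def prod_dividef prod.distrib power_mult_distrib mult_ac)
qed

lemma Ekernel_hom_polys: "(\<lambda>\<zeta>. Ekernel l \<zeta> \<omega>) \<in> hom_polys l"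
  unfolding hom_polys_def
  by (auto simp: Ekernel_eq_sum_monomial
      intro!: exI[of _ "\<lambda>\<alpha>. cnj (monomial \<alpha> \<omega>) / (\<Prod>i\<in>UNIV. fact (\<alpha> i))"])

lemma cnj_cdot: "cnj (cdot u v) = cdot v u"
  by (simp add: cdot_def mult_ac)

lemma cnj_Ekernel: "cnj (Ekernel l u v) = Ekernel l v u"
  by (simp add: Ekernel_def cnj_cdot)

lemma fock_sum_monomial:
  fixes a b :: "('d::finite \<Rightarrow> nat) \<Rightarrow> complex"
  assumes "finite A"
  shows "fock (\<lambda>\<zeta>. \<Sum>\<alpha>\<in>A. a \<alpha> * monomial \<alpha> \<zeta>) (\<lambda>\<zeta>. \<Sum>\<alpha>\<in>A. b \<alpha> * monomial \<alpha> \<zeta>)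
    = (\<Sum>\<alpha>\<in>A. cnj (a \<alpha>) * b \<alpha> * (\<Prod>i\<in>UNIV. fact (\<alpha> i)))"
proof -
  let ?w = "\<lambda>\<alpha> \<beta> (\<omega>::complex ^ 'd).
    exp (- cdot \<omega> \<omega>) / of_real pi ^ CARD('d) * cnj (monomial \<alpha> \<omega>) * monomial \<beta> \<omega>"
  have "fock (\<lambda>\<zeta>. \<Sum>\<alpha>\<in>A. a \<alpha> * monomial \<alpha> \<zeta>) (\<lambda>\<zeta>. \<Sum>\<alpha>\<in>A. b \<alpha> * monomial \<alpha> \<zeta>)
      = (\<integral>\<omega>. (\<Sum>\<alpha>\<in>A. \<Sum>\<beta>\<in>A. cnj (a \<alpha>) * b \<beta> * ?w \<alpha> \<beta> \<omega>) \<partial>lborel)"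
  proof -
    have "W * cnj (\<Sum>\<alpha>\<in>A. a \<alpha> * monomial \<alpha> \<omega>) * (\<Sum>\<beta>\<in>A. b \<beta> * monomial \<beta> \<omega>)
        = (\<Sum>\<alpha>\<in>A. \<Sum>\<beta>\<in>A. cnj (a \<alpha>) * b \<beta> * (W * cnj (monomial \<alpha> \<omega>) * monomial \<beta> \<omega>))"
      for W and \<omega> :: "complex ^ 'd"
      by (simp only: cnj_sum mult.assoc sum_product) (simp add: sum_distrib_left mult_ac)
    then show ?thesis
      unfolding fock_def by presburger
  qed
  also have "\<dots> = (\<Sum>\<alpha>\<in>A. \<Sum>\<beta>\<in>A. \<integral>\<omega>. cnj (a \<alpha>) * b \<beta> * ?w \<alpha> \<beta> \<omega> \<partial>lborel)"
    by (subst Bochner_Integration.integral_sum Bochner_Integration.integrable_sum,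
        intro Bochner_Integration.integrable_sum integrable_mult_right integrable_fock_monomial)+
       (intro refl)
  also have "\<dots> = (\<Sum>\<alpha>\<in>A. \<Sum>\<beta>\<in>A. cnj (a \<alpha>) * b \<beta> * fock (monomial \<alpha>) (monomial \<beta>))"
    unfolding fock_def by (simp only: integral_mult_right_zero)
  also have "\<dots> = (\<Sum>\<alpha>\<in>A. cnj (a \<alpha>) * b \<alpha> * (\<Prod>i\<in>UNIV. fact (\<alpha> i)))"
    using assms by (simp add: fock_monomial if_distrib cong: if_cong)
  finally show ?thesis .
qed

text \<open>The squared norm of each monomial cancels its denominator in \<open>Ekernel\<close>,
  which leaves the monomial expansion of \<psi> at \<eta>.\<close>

theorem fock_reproducing:
  assumes "\<psi> \<in> hom_polys l"
  shows "fock (\<lambda>\<omega>. Ekernel l \<omega> \<eta>) \<psi> = \<psi> \<eta>"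
proof -
  obtain b where b: "\<psi> = (\<lambda>\<zeta>. \<Sum>\<alpha>\<in>multi_indices l. b \<alpha> * monomial \<alpha> \<zeta>)"
    using assms by (auto simp: hom_polys_def)
  show ?thesis
    unfolding Ekernel_eq_sum_monomial b
    by (subst fock_sum_monomial) (simp_all add: mult_ac)
qed


section \<open>Parseval's identity for limits of inner product functionals\<close>

context polymap_hilbert_space
begin

lemma H_add: "f \<in> H \<Longrightarrow> g \<in> H \<Longrightarrow> f + g \<in> H"
  and H_scale: "f \<in> H \<Longrightarrow> cscale a f \<in> H"
  and H_0: "0 \<in> H"
  and H_diff: "f \<in> H \<Longrightarrow> g \<in> H \<Longrightarrow> f - g \<in> H"
  and H_sum: "(\<And>i. i \<in> A \<Longrightarrow> h i \<in> H) \<Longrightarrow> sum h A \<in> H"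
  using module.subspace_add[OF module_cscale subspace] module.subspace_scale[OF module_cscale subspace]
    module.subspace_0[OF module_cscale subspace] module.subspace_diff[OF module_cscale subspace]
    module.subspace_sum[OF module_cscale subspace] by blast+

lemma ip_add_left: "\<lbrakk>f \<in> H; g \<in> H; h \<in> H\<rbrakk> \<Longrightarrow> ip (f + g) h = ip f h + ip g h"
  by (subst (1 2 3) ip_cnj) (simp_all add: ip_add H_add)

lemma ip_scale_left: "\<lbrakk>f \<in> H; g \<in> H\<rbrakk> \<Longrightarrow> ip (cscale a f) g = cnj a * ip f g"
  by (subst (1 2) ip_cnj) (simp_all add: ip_scale H_scale)

lemma ip_diff: "\<lbrakk>f \<in> H; g \<in> H; h \<in> H\<rbrakk> \<Longrightarrow> ip f (g - h) = ip f g - ip f h"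
  using ip_add[of f "g - h" h] by (simp add: H_diff)

lemma ip_diff_left: "\<lbrakk>f \<in> H; g \<in> H; h \<in> H\<rbrakk> \<Longrightarrow> ip (f - g) h = ip f h - ip g h"
  using ip_add_left[of "f - g" g h] by (simp add: H_diff)

lemma ip_0: "f \<in> H \<Longrightarrow> ip f 0 = 0" "f \<in> H \<Longrightarrow> ip 0 f = 0"
  using ip_diff[of f f f] ip_diff_left[of f f f] by auto

lemma ip_sum: "\<lbrakk>f \<in> H; \<And>i. i \<in> A \<Longrightarrow> h i \<in> H\<rbrakk> \<Longrightarrow> ip f (sum h A) = (\<Sum>i\<in>A. ip f (h i))"
  by (induction A rule: infinite_finite_induct) (simp_all add: ip_0 ip_add H_sum)

lemma ip_sum_left: "\<lbrakk>f \<in> H; \<And>i. i \<in> A \<Longrightarrow> h i \<in> H\<rbrakk> \<Longrightarrow> ip (sum h A) f = (\<Sum>i\<in>A. ip (h i) f)"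
  by (induction A rule: infinite_finite_induct) (simp_all add: ip_0 ip_add_left H_sum)

definition nrm :: "'d polymap \<Rightarrow> real" where
  "nrm f = sqrt (Re (ip f f))"

lemma nrm_nonneg: "f \<in> H \<Longrightarrow> 0 \<le> nrm f"
  by (simp add: nrm_def ip_nonneg)

lemma ip_self:
  assumes "f \<in> H"
  shows "ip f f = of_real ((nrm f)\<^sup>2)"
proof -
  have "Im (ip f f) = 0"
    using arg_cong[OF ip_cnj[OF assms assms], of Im] by simp
  then show ?thesis
    using ip_nonneg[OF assms] by (simp add: nrm_def complex_eq_iff)
qed

lemma nrm_eq_0:
  assumes "f \<in> H"
  shows "nrm f = 0 \<longleftrightarrow> f = 0"
proof
  assume "nrm f = 0"
  then have "ip f f = 0"
    by (simp add: ip_self assms)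
  then show "f = 0"
    by (rule ip_definite[OF assms])
next
  assume "f = 0"
  then show "nrm f = 0"
    by (simp add: nrm_def ip_0 H_0)
qed

lemma Cauchy_Schwarz_ip:
  assumes f: "f \<in> H" and g: "g \<in> H"
  shows "norm (ip f g) \<le> nrm f * nrm g"
proof (cases "f = 0")
  case True
  then show ?thesis using g by (simp add: ip_0 nrm_def H_0)
next
  case False
  then have n0: "nrm f > 0" using nrm_eq_0[OF f] nrm_nonneg[OF f] by linarith
  \<comment> \<open>Coefficient of the projection of \<open>g\<close> to the line of
    \<open>f\<close>; the squared norm of the remainder is nonnegative.\<close>
  define c where "c = ip f g / ip f f"
  have ff: "ip f f \<noteq> 0" using n0 by (simp add: ip_self f)
  have h: "cscale c f \<in> H" "g - cscale c f \<in> H" using f g by (auto intro: H_scale H_diff)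
  have gf: "ip g f = cnj (ip f g)" by (rule ip_cnj[OF f g])
  have "ip (g - cscale c f) (g - cscale c f) = ip g g - c * ip g f - cnj c * (ip f g - c * ip f f)"
    by (simp add: ip_diff ip_diff_left ip_scale ip_scale_left f g h algebra_simps)
  also have "\<dots> = ip g g - c * ip g f"
    using ff by (simp add: c_def)
  also have "\<dots> = of_real ((nrm g)\<^sup>2 - (norm (ip f g))\<^sup>2 / (nrm f)\<^sup>2)"
    using complex_norm_square[of "ip f g"] by (simp add: c_def gf ip_self f g)
  finally have "0 \<le> (nrm g)\<^sup>2 - (norm (ip f g))\<^sup>2 / (nrm f)\<^sup>2"
    using ip_nonneg[OF h(2)] by simp
  then have "(norm (ip f g))\<^sup>2 \<le> (nrm f * nrm g)\<^sup>2"
    using n0 by (simp add: field_simps power_mult_distrib)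
  then show ?thesis
    using f g by (auto intro: power2_le_imp_le mult_nonneg_nonneg nrm_nonneg)
qed

section \<open>Functionals with approximate representers\<close>

definition linear_on_H :: "('d polymap \<Rightarrow> complex) \<Rightarrow> bool" where
  "linear_on_H L \<longleftrightarrow> (\<forall>f\<in>H. \<forall>g\<in>H. L (f + g) = L f + L g) \<and> (\<forall>a. \<forall>f\<in>H. L (cscale a f) = a * L f)"

lemma linear_on_H_sum:
  assumes L: "linear_on_H L" and h: "\<And>i. i \<in> A \<Longrightarrow> h i \<in> H"
  shows "L (sum h A) = (\<Sum>i\<in>A. L (h i))"
proof -
  have "L 0 = 0"
    using L H_0 unfolding linear_on_H_def by (metis add_cancel_right_right)
  with h show ?thesis
    using L by (induction A rule: infinite_finite_induct) (simp_all add: linear_on_H_def H_sum)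
qed

lemma linear_on_H_diff:
  assumes L: "linear_on_H L" and f: "f \<in> H" and g: "g \<in> H"
  shows "L (f - g) = L f - L g"
proof -
  have "L (f - g + g) = L (f - g) + L g"
    using assms H_diff unfolding linear_on_H_def by blast
  then show ?thesis by simp
qed

text \<open>The functional \<open>M\<close> is a norm limit of functionals \<open>ip v\<close>, and \<open>s\<close> is the limit of \<open>L v\<close>:
  \<open>s\<close> is the value of \<open>L\<close> at the Riesz representer of \<open>M\<close> in the completion of \<open>H\<close>.\<close>

definition represents ::
  "('d polymap \<Rightarrow> complex) \<Rightarrow> ('d polymap \<Rightarrow> complex) \<Rightarrow> complex \<Rightarrow> bool" where
  "represents L M s \<longleftrightarrow>
     (\<forall>\<epsilon>>0. \<exists>v\<in>H. (\<forall>\<Phi>\<in>H. norm (M \<Phi> - ip v \<Phi>) \<le> \<epsilon> * nrm \<Phi>) \<and> norm (L v - s) \<le> \<epsilon>)"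

lemma represents_ip: "v \<in> H \<Longrightarrow> represents L (ip v) (L v)"
  unfolding represents_def by (auto intro!: bexI[of _ v] simp: nrm_nonneg)

lemma represents_limit:
  assumes "\<And>\<epsilon>. \<epsilon> > 0 \<Longrightarrow> \<exists>M' s'. represents L M' s' \<and>
      (\<forall>\<Phi>\<in>H. norm (M \<Phi> - M' \<Phi>) \<le> \<epsilon> * nrm \<Phi>) \<and> norm (s - s') \<le> \<epsilon>"
  shows "represents L M s"
  unfolding represents_def
proof (intro allI impI)
  fix \<epsilon> :: real assume "\<epsilon> > 0"
  then have e: "\<epsilon> / 2 > 0" by simp
  obtain M' s' where M': "represents L M' s'" "\<And>\<Phi>. \<Phi> \<in> H \<Longrightarrow> norm (M \<Phi> - M' \<Phi>) \<le> \<epsilon> / 2 * nrm \<Phi>"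
      "norm (s - s') \<le> \<epsilon> / 2"
    using assms[OF e] by blast
  obtain v where v: "v \<in> H" "\<And>\<Phi>. \<Phi> \<in> H \<Longrightarrow> norm (M' \<Phi> - ip v \<Phi>) \<le> \<epsilon> / 2 * nrm \<Phi>"
      "norm (L v - s') \<le> \<epsilon> / 2"
    using M'(1) e unfolding represents_def by blast
  have "norm (M \<Phi> - ip v \<Phi>) \<le> \<epsilon> * nrm \<Phi>" if "\<Phi> \<in> H" for \<Phi>
    using norm_triangle_ineq[of "M \<Phi> - M' \<Phi>" "M' \<Phi> - ip v \<Phi>"] M'(2)[OF that] v(2)[OF that]
    by simp
  moreover have "norm (L v - s) \<le> \<epsilon>"
    using norm_triangle_ineq4[of "L v - s'" "s - s'"] M'(3) v(3) by simp
  ultimately show "\<exists>v\<in>H. (\<forall>\<Phi>\<in>H. norm (M \<Phi> - ip v \<Phi>) \<le> \<epsilon> * nrm \<Phi>) \<and> norm (L v - s) \<le> \<epsilon>"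
    using v(1) by blast
qed

text \<open>\<open>ip\<close> is conjugate-linear in its first argument, so the vector for
  \<open>c * M'\<close> is scaled by \<open>cnj c\<close>, and so is the value of \<open>L\<close>
  on it.\<close>

lemma represents_add_scale:
  assumes L: "linear_on_H L" and M: "represents L M s" and M': "represents L M' s'"
  shows "represents L (\<lambda>\<Phi>. M \<Phi> + c * M' \<Phi>) (s + cnj c * s')"
  unfolding represents_def
proof (intro allI impI)
  fix \<epsilon> :: real assume "\<epsilon> > 0"
  define \<delta> where "\<delta> = \<epsilon> / (1 + norm c)"
  have "\<delta> > 0" using \<open>\<epsilon> > 0\<close> by (simp add: \<delta>_def add_pos_nonneg)
  have "1 + norm c \<noteq> 0"
    using add_pos_nonneg[OF zero_less_one norm_ge_zero[of c]] by simp
  then have "\<delta> * (1 + norm c) = \<epsilon>"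
    by (simp add: \<delta>_def)
  then have \<delta>: "\<delta> + norm c * \<delta> = \<epsilon>"
    by (simp add: algebra_simps)
  obtain v where v: "v \<in> H" "\<And>\<Phi>. \<Phi> \<in> H \<Longrightarrow> norm (M \<Phi> - ip v \<Phi>) \<le> \<delta> * nrm \<Phi>" "norm (L v - s) \<le> \<delta>"
    using M \<open>\<delta> > 0\<close> unfolding represents_def by blast
  obtain w where w: "w \<in> H" "\<And>\<Phi>. \<Phi> \<in> H \<Longrightarrow> norm (M' \<Phi> - ip w \<Phi>) \<le> \<delta> * nrm \<Phi>" "norm (L w - s') \<le> \<delta>"
    using M' \<open>\<delta> > 0\<close> unfolding represents_def by blast
  define x where "x = v + cscale (cnj c) w"
  have x: "x \<in> H" using v w by (simp add: x_def H_add H_scale)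
  have "norm (M \<Phi> + c * M' \<Phi> - ip x \<Phi>) \<le> \<epsilon> * nrm \<Phi>" if "\<Phi> \<in> H" for \<Phi>
  proof -
    have "M \<Phi> + c * M' \<Phi> - ip x \<Phi> = (M \<Phi> - ip v \<Phi>) + c * (M' \<Phi> - ip w \<Phi>)"
      using that v w by (simp add: x_def ip_add_left ip_scale_left H_scale algebra_simps)
    also have "norm \<dots> \<le> \<delta> * nrm \<Phi> + norm c * (\<delta> * nrm \<Phi>)"
      using v(2)[OF that] w(2)[OF that]
      by (intro order_trans[OF norm_triangle_ineq] add_mono) (auto simp: norm_mult intro: mult_left_mono)
    also have "\<dots> = \<epsilon> * nrm \<Phi>"
      by (simp flip: \<delta> add: algebra_simps)
    finally show ?thesis .
  qed
  moreover have "norm (L x - (s + cnj c * s')) \<le> \<epsilon>"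
  proof -
    have "L x - (s + cnj c * s') = (L v - s) + cnj c * (L w - s')"
      using L v w by (simp add: x_def linear_on_H_def H_scale algebra_simps)
    also have "norm \<dots> \<le> \<delta> + norm c * \<delta>"
      using v(3) w(3)
      by (intro order_trans[OF norm_triangle_ineq] add_mono) (auto simp: norm_mult intro: mult_left_mono)
    finally show ?thesis by (simp only: \<delta>)
  qed
  ultimately show "\<exists>v\<in>H. (\<forall>\<Phi>\<in>H. norm (M \<Phi> + c * M' \<Phi> - ip v \<Phi>) \<le> \<epsilon> * nrm \<Phi>)
      \<and> norm (L v - (s + cnj c * s')) \<le> \<epsilon>"
    using x by blast
qed

lemma represents_0: "linear_on_H L \<Longrightarrow> represents L (\<lambda>_. 0) 0"
  using represents_limit[of L "\<lambda>_. 0" 0] represents_ip[OF H_0, of L] linear_on_H_sum[of L "{}"]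
  by (auto simp: represents_def nrm_nonneg ip_0 H_0 intro!: bexI[of _ 0])

lemma represents_scale:
  "linear_on_H L \<Longrightarrow> represents L M s \<Longrightarrow> represents L (\<lambda>\<Phi>. c * M \<Phi>) (cnj c * s)"
  using represents_add_scale[OF _ represents_0, of L M s c] by simp

lemma represents_sum:
  assumes L: "linear_on_H L" and "\<And>i. i \<in> A \<Longrightarrow> represents L (M i) (s i)"
  shows "represents L (\<lambda>\<Phi>. \<Sum>i\<in>A. c i * M i \<Phi>) (\<Sum>i\<in>A. cnj (c i) * s i)"
  using assms(2)
proof (induction A rule: infinite_finite_induct)
  case (insert i A)
  then show ?case
    using represents_add_scale[OF L, of "\<lambda>\<Phi>. \<Sum>i\<in>A. c i * M i \<Phi>" "\<Sum>i\<in>A. cnj (c i) * s i" "M i" "s i" "c i"]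
    by (simp add: add.commute)
qed (simp_all add: represents_0[OF L])

text \<open>A single approximation with \<epsilon> = 1, together with Cauchy-Schwarz, gives the
  bound.\<close>

lemma represents_imp_bounded:
  assumes "represents L M s"
  obtains K where "K \<ge> 0" "\<And>\<Phi>. \<Phi> \<in> H \<Longrightarrow> norm (M \<Phi>) \<le> K * nrm \<Phi>"
proof -
  obtain v where v: "v \<in> H" "\<And>\<Phi>. \<Phi> \<in> H \<Longrightarrow> norm (M \<Phi> - ip v \<Phi>) \<le> 1 * nrm \<Phi>"
    using assms zero_less_one unfolding represents_def by blast
  have "norm (M \<Phi>) \<le> (1 + nrm v) * nrm \<Phi>" if "\<Phi> \<in> H" for \<Phi>
    using norm_triangle_ineq[of "M \<Phi> - ip v \<Phi>" "ip v \<Phi>"] v(2)[OF that] Cauchy_Schwarz_ip[OF v(1) that]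
    by (simp add: distrib_right)
  then show ?thesis
    using nrm_nonneg[OF v(1)] by (intro that[of "1 + nrm v"]) auto
qed

text \<open>The defects of additivity and homogeneity vanish for every \<open>ip v\<close>; for
  \<open>M\<close> they are therefore at most \<epsilon> times a fixed constant, for every positive
  \<epsilon>.\<close>

lemma represents_imp_linear:
  assumes M: "represents L M s"
  shows "linear_on_H M"
proof -
  have zero: "x = 0" if "\<And>\<epsilon>. \<epsilon> > 0 \<Longrightarrow> norm (x :: complex) \<le> \<epsilon> * C" "C \<ge> 0" for x C
  proof (rule ccontr)
    assume "x \<noteq> 0"
    then have "norm x / (2 * (C + 1)) > 0"
      using that(2) by (simp add: add_nonneg_pos)
    from that(1)[OF this] have "norm x * (2 * (C + 1)) \<le> norm x * C"
      using that(2) by (simp add: field_simps)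
    moreover have "0 < norm x * (C + 2)"
      using \<open>x \<noteq> 0\<close> that(2) by (simp add: add_nonneg_pos)
    ultimately show False
      by (simp add: algebra_simps)
  qed
  have "M (f + g) = M f + M g" if f: "f \<in> H" and g: "g \<in> H" for f g
  proof -
    have "M (f + g) - M f - M g = 0"
    proof (rule zero)
      fix \<epsilon> :: real assume "\<epsilon> > 0"
      then obtain v where v: "v \<in> H" "\<And>\<Phi>. \<Phi> \<in> H \<Longrightarrow> norm (M \<Phi> - ip v \<Phi>) \<le> \<epsilon> * nrm \<Phi>"
        using M unfolding represents_def by blast
      have eq: "M (f + g) - M f - M g = (M (f + g) - ip v (f + g)) - (M f - ip v f) - (M g - ip v g)"
        using f g v by (simp add: ip_add)
      have "norm (M (f + g) - M f - M g) \<le> \<epsilon> * nrm (f + g) + \<epsilon> * nrm f + \<epsilon> * nrm g"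
        unfolding eq
        by (rule order_trans[OF norm_triangle_ineq4 add_mono[OF order_trans[OF norm_triangle_ineq4 add_mono]]])
          (intro v(2) H_add f g)+
      then show "norm (M (f + g) - M f - M g) \<le> \<epsilon> * (nrm (f + g) + nrm f + nrm g)"
        by (simp only: distrib_left)
    qed (use f g in \<open>simp add: nrm_nonneg H_add\<close>)
    then show ?thesis by (simp add: algebra_simps)
  qed
  moreover have "M (cscale a f) = a * M f" if f: "f \<in> H" for f a
  proof -
    have "M (cscale a f) - a * M f = 0"
    proof (rule zero)
      fix \<epsilon> :: real assume "\<epsilon> > 0"
      then obtain v where v: "v \<in> H" "\<And>\<Phi>. \<Phi> \<in> H \<Longrightarrow> norm (M \<Phi> - ip v \<Phi>) \<le> \<epsilon> * nrm \<Phi>"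
        using M unfolding represents_def by blast
      have eq: "M (cscale a f) - a * M f = (M (cscale a f) - ip v (cscale a f)) - a * (M f - ip v f)"
        using f v by (simp add: ip_scale algebra_simps)
      have "norm (M (cscale a f) - a * M f) \<le> \<epsilon> * nrm (cscale a f) + norm a * (\<epsilon> * nrm f)"
        unfolding eq
        by (rule order_trans[OF norm_triangle_ineq4 add_mono[OF v(2)[OF H_scale[OF f]]]])
          (simp add: norm_mult v(2) f mult_left_mono)
      then show "norm (M (cscale a f) - a * M f) \<le> \<epsilon> * (nrm (cscale a f) + norm a * nrm f)"
        by (simp only: distrib_left mult.left_commute)
    qed (use f in \<open>simp add: nrm_nonneg H_scale\<close>)
    then show ?thesis by simp
  qed
  ultimately show ?thesis
    by (simp add: linear_on_H_def)
qed

section \<open>Best approximation and Parseval's identity\<close>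

text \<open>The sum over \<open>Y\<close> is the orthogonal projection \<open>p\<close> of
  \<open>g\<close> to the span of \<open>Y\<close>, and the competitor \<open>h\<close> supported on
  \<open>F\<close> lies in that span. Pythagoras for \<open>g - p\<close> and \<open>p - h\<close>
  gives the bound.\<close>

lemma nrm_diff_proj_le:
  assumes on: "\<And>\<Phi> \<Psi>. \<Phi> \<in> Y \<Longrightarrow> \<Psi> \<in> Y \<Longrightarrow> ip \<Phi> \<Psi> = (if \<Phi> = \<Psi> then 1 else 0)"
    and Y: "finite Y" "Y \<subseteq> H" and F: "F \<subseteq> Y" and g: "g \<in> H"
  shows "nrm (g - (\<Sum>\<Phi>\<in>Y. cscale (ip \<Phi> g) \<Phi>)) \<le> nrm (g - (\<Sum>\<Phi>\<in>F. cscale (r \<Phi>) \<Phi>))"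
proof -
  define p where "p = (\<Sum>\<Phi>\<in>Y. cscale (ip \<Phi> g) \<Phi>)"
  define h where "h = (\<Sum>\<Phi>\<in>F. cscale (r \<Phi>) \<Phi>)"
  have YH: "\<Phi> \<in> H" if "\<Phi> \<in> Y" for \<Phi> using that Y by blast
  have pH: "p \<in> H" unfolding p_def by (intro H_sum H_scale YH)
  have hH: "h \<in> H" unfolding h_def using YH F by (intro H_sum H_scale) auto
  have "ip \<Phi> p = ip \<Phi> g" if "\<Phi> \<in> Y" for \<Phi>
  proof -
    have "ip \<Phi> p = (\<Sum>\<Psi>\<in>Y. ip \<Psi> g * ip \<Phi> \<Psi>)"
      using that YH unfolding p_def by (simp add: ip_sum ip_scale H_scale)
    also have "\<dots> = (\<Sum>\<Psi>\<in>Y. if \<Psi> = \<Phi> then ip \<Psi> g else 0)"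
      using that on by (intro sum.cong) auto
    finally show ?thesis using that Y by simp
  qed
  then have orth: "ip \<Phi> (g - p) = 0" if "\<Phi> \<in> Y" for \<Phi>
    using that YH pH g by (simp add: ip_diff)
  have "ip p (g - p) = (\<Sum>\<Phi>\<in>Y. ip (cscale (ip \<Phi> g) \<Phi>) (g - p))"
    by (subst (1) p_def, rule ip_sum_left) (use pH YH g in \<open>auto intro: H_diff H_scale\<close>)
  also have "\<dots> = 0"
    using YH pH g orth by (intro sum.neutral) (simp add: ip_scale_left H_diff)
  finally have 1: "ip p (g - p) = 0" .
  have "ip h (g - p) = (\<Sum>\<Phi>\<in>F. ip (cscale (r \<Phi>) \<Phi>) (g - p))"
    unfolding h_def by (rule ip_sum_left) (use pH YH g F in \<open>auto intro: H_diff H_scale\<close>)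
  also have "\<dots> = 0"
    using YH pH g orth F by (intro sum.neutral) (auto simp: ip_scale_left H_diff)
  finally have 2: "ip h (g - p) = 0" .
  have "ip (p - h) (g - p) = 0"
    using pH hH g 1 2 by (simp add: ip_diff_left H_diff)
  moreover have "ip (g - p) (p - h) = cnj (ip (p - h) (g - p))"
    using pH hH g by (intro ip_cnj H_diff)
  moreover have "ip (g - h) (g - h) = ip ((g - p) + (p - h)) ((g - p) + (p - h))"
    by simp
  ultimately have "ip (g - h) (g - h) = ip (g - p) (g - p) + ip (p - h) (p - h)"
    using pH hH g by (simp only: ip_add ip_add_left H_add H_diff) simp
  then show ?thesis
    using ip_nonneg[OF H_diff[OF pH hH]] by (simp add: nrm_def flip: p_def h_def)
qed

text \<open>If \<open>M\<close> is close to \<open>ip v\<close>, then \<open>cnj (M \<Phi>)\<close>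
  is close to \<open>ip \<Phi> v\<close>, and the partial sum over \<open>Y\<close> is close to
  \<open>L\<close> at the projection of \<open>v\<close> to the span of \<open>Y\<close>, hence to
  \<open>L v\<close> and to \<open>s\<close>. The premise on \<open>L0\<close> supplies linearity
  and boundedness of \<open>L\<close>.\<close>

lemma has_sum_Parseval:
  assumes B: "orthonormal_basis H ip B" and L: "represents L0 L s0" and M: "represents L M s"
  shows "((\<lambda>\<Phi>. L \<Phi> * cnj (M \<Phi>)) has_sum s) B"
  unfolding has_sum_def tendsto_iff eventually_finite_subsets_at_top
proof (intro allI impI)
  fix \<epsilon> :: real assume e: "\<epsilon> > 0"
  have BH: "B \<subseteq> H" and on: "\<And>\<Phi> \<Psi>. \<Phi> \<in> B \<Longrightarrow> \<Psi> \<in> B \<Longrightarrow> ip \<Phi> \<Psi> = (if \<Phi> = \<Psi> then 1 else 0)"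
    and dense: "\<And>g \<delta>. g \<in> H \<Longrightarrow> \<delta> > 0 \<Longrightarrow> \<exists>h\<in>module.span cscale B. nrm (g - h) < \<delta>"
    using B by (auto simp: orthonormal_basis_def nrm_def)
  have lin: "linear_on_H L" "linear_on_H M"
    using L M represents_imp_linear by blast+
  obtain K where K: "K \<ge> 0" "\<And>\<Phi>. \<Phi> \<in> H \<Longrightarrow> norm (L \<Phi>) \<le> K * nrm \<Phi>"
    using represents_imp_bounded[OF L] by blast
  \<comment> \<open>The three errors below are \<open>K * \<delta>\<close>,
    \<open>K * \<delta>\<close> and \<open>\<delta>\<close>; the summand \<open>2\<close> instead of
    \<open>1\<close> makes their total strictly smaller than \<epsilon>.\<close>
  define \<delta> where "\<delta> = \<epsilon> / (2 * K + 2)"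
  have "\<delta> > 0" using e K(1) by (simp add: \<delta>_def)
  have \<delta>: "K * \<delta> + K * \<delta> + \<delta> < \<epsilon>"
  proof -
    have "\<delta> * (2 * K + 2) = \<epsilon>"
      using K(1) by (simp add: \<delta>_def)
    with \<open>\<delta> > 0\<close> show ?thesis
      by (simp add: algebra_simps)
  qed
  obtain v where v: "v \<in> H" "\<And>\<Phi>. \<Phi> \<in> H \<Longrightarrow> norm (M \<Phi> - ip v \<Phi>) \<le> \<delta> * nrm \<Phi>" "norm (L v - s) \<le> \<delta>"
    using M \<open>\<delta> > 0\<close> unfolding represents_def by blast
  obtain h where h: "h \<in> module.span cscale B" "nrm (v - h) < \<delta>"
    using dense v(1) \<open>\<delta> > 0\<close> by blast
  from h(1) obtain F r where F: "finite F" "F \<subseteq> B" "h = (\<Sum>\<Phi>\<in>F. cscale (r \<Phi>) \<Phi>)"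
    unfolding module.span_explicit[OF module_cscale] by blast
  show "\<exists>X. finite X \<and> X \<subseteq> B \<and> (\<forall>Y. finite Y \<and> X \<subseteq> Y \<and> Y \<subseteq> B \<longrightarrow>
      dist (\<Sum>\<Phi>\<in>Y. L \<Phi> * cnj (M \<Phi>)) s < \<epsilon>)"
  \<comment> \<open>The support of the approximation \<open>h\<close> is the threshold: for every
    larger \<open>Y\<close> the projection of \<open>v\<close> is at least as close to
    \<open>v\<close> as \<open>h\<close>.\<close>
  proof (intro exI[of _ F] conjI allI impI; (elim conjE)?)
    fix Y assume Y: "finite Y" "F \<subseteq> Y" "Y \<subseteq> B"
    have YH: "\<Phi> \<in> H" if "\<Phi> \<in> Y" for \<Phi> using that Y BH by blast
    have onY: "ip \<Phi> \<Psi> = (if \<Phi> = \<Psi> then 1 else 0)" if "\<Phi> \<in> Y" "\<Psi> \<in> Y" for \<Phi> \<Psi>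
      using that Y by (intro on) auto
    define p where "p = (\<Sum>\<Phi>\<in>Y. cscale (ip \<Phi> v) \<Phi>)"
    \<comment> \<open>\<open>q\<close> represents \<open>L\<close> on the span of \<open>Y\<close>.
      The errors from replacing \<open>M\<close> by \<open>ip v\<close> add up to the conjugate of
      \<open>M q - ip v q\<close>, and \<open>(nrm q)\<^sup>2 = norm (L q)\<close> gives
      \<open>nrm q \<le> K\<close>, a bound independent of \<open>Y\<close>.\<close>
    define q where "q = (\<Sum>\<Phi>\<in>Y. cscale (cnj (L \<Phi>)) \<Phi>)"
    have pH: "p \<in> H" and qH: "q \<in> H"
      unfolding p_def q_def by (intro H_sum H_scale YH; assumption)+
    have "nrm (v - p) \<le> nrm (v - h)"
      unfolding p_def F(3) using Y YH v(1) by (intro nrm_diff_proj_le on) auto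
    with h(2) have vp: "nrm (v - p) \<le> \<delta>" by simp
    have Lp: "L p = (\<Sum>\<Phi>\<in>Y. L \<Phi> * ip \<Phi> v)"
      unfolding p_def using lin(1) YH
      by (subst linear_on_H_sum) (auto simp: linear_on_H_def H_scale intro!: sum.cong)
    have Mq: "M q - ip v q = (\<Sum>\<Phi>\<in>Y. cnj (L \<Phi>) * (M \<Phi> - ip v \<Phi>))"
      unfolding q_def using lin(2) YH v(1)
      by (subst linear_on_H_sum, simp, simp add: H_scale, subst ip_sum)
         (auto simp: linear_on_H_def H_scale ip_scale algebra_simps simp flip: sum_subtractf intro!: sum.cong)
    have Lq: "L q = (\<Sum>\<Phi>\<in>Y. cnj (L \<Phi>) * L \<Phi>)"
      unfolding q_def using lin(1) YH
      by (subst linear_on_H_sum) (auto simp: linear_on_H_def H_scale intro!: sum.cong)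
    have iq: "ip q \<Phi> = L \<Phi>" if "\<Phi> \<in> Y" for \<Phi>
    proof -
      have "ip q \<Phi> = (\<Sum>\<Psi>\<in>Y. L \<Psi> * ip \<Psi> \<Phi>)"
        unfolding q_def using YH that by (subst ip_sum_left) (auto simp: ip_scale_left H_scale)
      also have "\<dots> = (\<Sum>\<Psi>\<in>Y. if \<Psi> = \<Phi> then L \<Psi> else 0)"
        using that onY by (intro sum.cong) auto
      finally show ?thesis using that Y by simp
    qed
    have "ip q q = (\<Sum>\<Phi>\<in>Y. ip q (cscale (cnj (L \<Phi>)) \<Phi>))"
      by (subst (2) q_def, rule ip_sum) (use qH YH in \<open>auto intro: H_scale\<close>)
    also have "\<dots> = L q"
      unfolding Lq using qH YH iq by (intro sum.cong) (auto simp: ip_scale)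
    finally have "(nrm q)\<^sup>2 = norm (L q)"
      using ip_self[OF qH] by (metis norm_of_real abs_power2)
    also have "\<dots> \<le> K * nrm q" by (rule K(2)[OF qH])
    finally have nq: "nrm q \<le> K"
      using K(1) nrm_nonneg[OF qH] by (cases "nrm q = 0") (auto simp: power2_eq_square)
    have 1: "norm (\<Sum>\<Phi>\<in>Y. L \<Phi> * (cnj (M \<Phi>) - ip \<Phi> v)) \<le> K * \<delta>"
    proof -
      have "(\<Sum>\<Phi>\<in>Y. L \<Phi> * (cnj (M \<Phi>) - ip \<Phi> v)) = cnj (M q - ip v q)"
        unfolding Mq using YH v(1) by (auto simp: ip_cnj[of v] intro!: sum.cong)
      then have "norm (\<Sum>\<Phi>\<in>Y. L \<Phi> * (cnj (M \<Phi>) - ip \<Phi> v)) \<le> \<delta> * nrm q"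
        using v(2)[OF qH] by (simp only: complex_mod_cnj)
      also have "\<dots> \<le> \<delta> * K"
        using nq \<open>\<delta> > 0\<close> by (intro mult_left_mono) auto
      finally show ?thesis by (simp add: mult.commute)
    qed
    have 2: "norm (L p - L v) \<le> K * \<delta>"
    proof -
      have "norm (L p - L v) = norm (L (v - p))"
        using linear_on_H_diff[OF lin(1) v(1) pH] by (simp add: norm_minus_commute)
      also have "\<dots> \<le> K * nrm (v - p)" using v(1) pH by (intro K(2) H_diff)
      also have "\<dots> \<le> K * \<delta>" using vp K(1) by (intro mult_left_mono)
      finally show ?thesis .
    qed
    have "(\<Sum>\<Phi>\<in>Y. L \<Phi> * cnj (M \<Phi>)) - s
        = (\<Sum>\<Phi>\<in>Y. L \<Phi> * (cnj (M \<Phi>) - ip \<Phi> v)) + (L p - L v) + (L v - s)"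
      by (simp add: Lp algebra_simps sum_subtractf)
    also have "norm \<dots> \<le> K * \<delta> + K * \<delta> + \<delta>"
      using 1 2 v(3) by (intro order_trans[OF norm_triangle_ineq] add_mono) auto
    finally show "dist (\<Sum>\<Phi>\<in>Y. L \<Phi> * cnj (M \<Phi>)) s < \<epsilon>"
      using \<delta> by (simp add: dist_norm)
  qed (use F in auto)
qed

end


section \<open>The kernel along rays and its Taylor coefficients\<close>

lemma cdot_scale_left: "cdot (a *s u) v = a * cdot u v"
  by (simp add: cdot_def sum_distrib_left mult_ac)

lemma cdot_scale_right: "cdot u (a *s v) = cnj a * cdot u v"
  by (simp add: cdot_def sum_distrib_left mult_ac)

lemma cdot_diff_left: "cdot (u - v) w = cdot u w - cdot v w"
  by (simp add: cdot_def sum_subtractf algebra_simps)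

lemma norm_cdot_le: "norm (cdot u v) \<le> norm u * norm v"
proof -
  have "norm (cdot u v) \<le> (\<Sum>i\<in>UNIV. \<bar>norm (u $ i)\<bar> * \<bar>norm (v $ i)\<bar>)"
    unfolding cdot_def by (rule order_trans[OF norm_sum]) (simp add: norm_mult)
  also have "\<dots> \<le> norm u * norm v"
    unfolding norm_vec_def by (rule L2_set_mult_ineq)
  finally show ?thesis .
qed

lemma norm_cdot_less_1:
  assumes "z \<in> D" "w \<in> D"
  shows "norm (cdot z w) < 1"
proof -
  have "norm z * norm w < 1 * 1"
    using assms by (intro mult_strict_mono') (auto simp: D_def)
  then show ?thesis
    using norm_cdot_le[of z w] by simp
qed

lemma norm_smult_vec: "norm (a *s (v :: complex ^ 'd)) = norm a * norm v"
  by (simp add: norm_vec_def norm_mult L2_set_right_distrib)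

text \<open>A vector \<open>v\<close> in the null space is \<open>cdot v w *s z\<close>; pairing
  with \<open>w\<close> forces \<open>cdot v w = 0\<close>, as \<open>cdot z w\<close> is not
  \<open>1\<close>. Injectivity allows \<open>inv\<close> to be evaluated by exhibiting a
  preimage.\<close>

lemma inj_Bop:
  assumes "z \<in> D" "w \<in> D"
  shows "inj (Bop z w)"
proof -
  have n1: "1 - cdot z w \<noteq> 0"
    using norm_cdot_less_1[OF assms] by auto
  have "x = y" if "Bop z w x = Bop z w y" for x y
  proof -
    define v where "v = x - y"
    have "(1 - cdot z w) *s (v - cdot v w *s z) = 0"
      using that by (simp add: Bop_def v_def cdot_diff_left algebra_simps vec_eq_iff)
    then have v: "v = cdot v w *s z"
      using n1 by (simp only: vector_mul_eq_0) simp
    then have "cdot v w = cdot v w * cdot z w"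
      by (metis cdot_scale_left)
    then have "cdot v w = 0"
      using n1 by simp
    with v show "x = y"
      by (simp add: v_def)
  qed
  then show ?thesis by (rule injI)
qed

lemma inv_Bop_ray:
  assumes "s *s \<zeta> \<in> D" "t *s \<omega> \<in> D"
  shows "inv (Bop (s *s \<zeta>) (t *s \<omega>)) \<zeta> = (1 / (1 - s * cnj t * cdot \<zeta> \<omega>)\<^sup>2) *s \<zeta>"
proof (rule inv_f_eq[OF inj_Bop[OF assms]])
  define d where "d = 1 - s * cnj t * cdot \<zeta> \<omega>"
  have "d \<noteq> 0"
    using norm_cdot_less_1[OF assms] by (auto simp: d_def cdot_scale_left cdot_scale_right mult_ac)
  have "Bop (s *s \<zeta>) (t *s \<omega>) (a *s \<zeta>) = (d * d * a) *s \<zeta>" for a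
    by (simp add: Bop_def cdot_scale_left cdot_scale_right vec_eq_iff d_def algebra_simps)
  then show "Bop (s *s \<zeta>) (t *s \<omega>) ((1 / (1 - s * cnj t * cdot \<zeta> \<omega>)\<^sup>2) *s \<zeta>) = \<zeta>"
    using \<open>d \<noteq> 0\<close> by (simp add: power2_eq_square flip: d_def)
qed

lemma kernel_map_ray:
  assumes D: "s *s \<zeta> \<in> D" "t *s \<omega> \<in> D"
  shows "kernel_map \<nu> l (t *s \<omega>) (\<lambda>\<xi>. Ekernel l \<xi> \<omega>) (s *s \<zeta>) \<zeta>
    = cdot \<zeta> \<omega> ^ l / fact l * (1 - s * cnj t * cdot \<zeta> \<omega>) powr (- of_real (\<nu> + 2 * real l))"
proof -
  define \<Delta> where "\<Delta> = 1 - s * cnj t * cdot \<zeta> \<omega>"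
  have \<Delta>: "\<Delta> \<noteq> 0" "Delta (s *s \<zeta>) (t *s \<omega>) = \<Delta>"
    using norm_cdot_less_1[OF D] by (auto simp: \<Delta>_def Delta_def cdot_scale_left cdot_scale_right mult_ac)
  let ?\<eta> = "(1 / \<Delta>\<^sup>2) *s \<zeta>"
  have "kernel_map \<nu> l (t *s \<omega>) (\<lambda>\<xi>. Ekernel l \<xi> \<omega>) (s *s \<zeta>) \<zeta>
      = fock (\<lambda>\<xi>. cnj (\<Delta> powr (- of_real \<nu>)) * Ekernel l \<xi> ?\<eta>) (\<lambda>\<xi>. Ekernel l \<xi> \<omega>)"
    using D by (simp add: kernel_map_def Knl_def \<Delta> inv_Bop_ray cnj_Ekernel flip: \<Delta>_def)
  also have "\<dots> = \<Delta> powr (- of_real \<nu>) * fock (\<lambda>\<xi>. Ekernel l \<xi> ?\<eta>) (\<lambda>\<xi>. Ekernel l \<xi> \<omega>)"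
    unfolding fock_def by (simp add: mult_ac flip: integral_mult_right_zero)
  also have "fock (\<lambda>\<xi>. Ekernel l \<xi> ?\<eta>) (\<lambda>\<xi>. Ekernel l \<xi> \<omega>) = Ekernel l ?\<eta> \<omega>"
    by (intro fock_reproducing Ekernel_hom_polys)
  also have "\<dots> = cdot \<zeta> \<omega> ^ l / fact l / \<Delta> ^ (2 * l)"
    by (simp add: Ekernel_def cdot_scale_left power_mult power_divide)
  \<comment> \<open>An integer power may be absorbed into the principal branch, so the exponent from
    \<open>Delta\<close> and the one from the homogeneity of degree \<open>l\<close> add up.\<close>
  also have "\<Delta> powr (- of_real \<nu>) * \<dots> = cdot \<zeta> \<omega> ^ l / fact l * \<Delta> powr (- of_real \<nu> - of_nat (2 * l))"
    using \<Delta>(1) by (simp add: powr_diff powr_nat' del: of_nat_mult)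
  finally show ?thesis
    by (simp add: \<Delta>_def)
qed

section \<open>Taylor coefficients along rays\<close>

text \<open>Taylor coefficient of \<Phi> along the ray of \<zeta>, equal to
  \<open>dir_deriv k \<Phi> 0 \<zeta> / fact k\<close>, the quantity in \<open>intertwiner\<close>
  at the origin.\<close>

definition ray_coeff :: "complex ^ 'd \<Rightarrow> nat \<Rightarrow> 'd polymap \<Rightarrow> complex" where
  "ray_coeff \<zeta> k \<Phi> = (deriv ^^ k) (\<lambda>t. \<Phi> (t *s \<zeta>) \<zeta>) 0 / fact k"

lemma scale_in_D: "norm t * norm \<zeta> < 1 \<Longrightarrow> t *s \<zeta> \<in> D"
  by (simp add: D_def norm_smult_vec)

text \<open>The summand \<open>1\<close> keeps the radius positive for \<open>\<zeta> = 0\<close> as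
  well.\<close>

lemma scale_in_D_radius: "norm t < 1 / (norm \<zeta> + 1) \<Longrightarrow> t *s \<zeta> \<in> D"
proof (rule scale_in_D)
  assume t: "norm t < 1 / (norm \<zeta> + 1)"
  have "norm \<zeta> + 1 > 0" by (simp add: add_nonneg_pos)
  with t have "norm t * (norm \<zeta> + 1) < 1" by (simp add: field_simps)
  then show "norm t * norm \<zeta> < 1"
    unfolding distrib_left using norm_ge_zero[of t] by linarith
qed

text \<open>The binomial series in \<open>s * cnj t\<close> ties the two orders together: the
  coefficient of \<open>s ^ k\<close> is a single power \<open>cnj t ^ k\<close>. A finite
  combination of these coefficients is thus a polynomial in \<open>cnj t\<close>, as required by
  \<open>represents_ray_coeff\<close>.\<close>

lemma ray_coeff_kernel_map:
  assumes t: "t *s \<omega> \<in> D"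
  shows "ray_coeff \<zeta> k (kernel_map \<nu> l (t *s \<omega>) (\<lambda>\<xi>. Ekernel l \<xi> \<omega>))
    = cdot \<zeta> \<omega> ^ (k + l) / fact l * (pochhammer (of_real (\<nu> + 2 * real l)) k / fact k) * cnj t ^ k"
proof -
  define a where "a = - complex_of_real (\<nu> + 2 * real l)"
  define u where "u = - (cnj t * cdot \<zeta> \<omega>)"
  define F where "F = fps_const (cdot \<zeta> \<omega> ^ l / fact l) * (fps_binomial a oo (fps_const u * fps_X))"
  have "((\<lambda>x. (1 + x) powr a) \<circ> (\<lambda>s. u * s)) has_fps_expansion (fps_binomial a oo (fps_const u * fps_X))"
    by (intro has_fps_expansion_compose fps_expansion_intros) auto
  then have "(\<lambda>s. cdot \<zeta> \<omega> ^ l / fact l * (1 + u * s) powr a) has_fps_expansion F"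
    unfolding F_def by (intro fps_expansion_intros) (simp add: comp_def)
  also have "?this \<longleftrightarrow> (\<lambda>s. kernel_map \<nu> l (t *s \<omega>) (\<lambda>\<xi>. Ekernel l \<xi> \<omega>) (s *s \<zeta>) \<zeta>) has_fps_expansion F"
  proof (intro has_fps_expansion_cong refl)
    have "\<forall>\<^sub>F s in nhds 0. s \<in> ball (0::complex) (1 / (norm \<zeta> + 1))"
      by (intro eventually_nhds_in_open) (auto simp: add_nonneg_pos)
    then show "\<forall>\<^sub>F s in nhds 0. cdot \<zeta> \<omega> ^ l / fact l * (1 + u * s) powr a
        = kernel_map \<nu> l (t *s \<omega>) (\<lambda>\<xi>. Ekernel l \<xi> \<omega>) (s *s \<zeta>) \<zeta>"
      by eventually_elim (simp add: kernel_map_ray t scale_in_D_radius u_def a_def mult_ac)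
  qed
  finally have 1: "fps_nth F k = ray_coeff \<zeta> k (kernel_map \<nu> l (t *s \<omega>) (\<lambda>\<xi>. Ekernel l \<xi> \<omega>))"
    unfolding ray_coeff_def by (rule fps_nth_fps_expansion)
  have 2: "fps_nth F k = cdot \<zeta> \<omega> ^ l / fact l * (u ^ k * (a gchoose k))"
    by (simp add: F_def fps_compose_linear)
  have 3: "u ^ k * (a gchoose k)
      = cnj t ^ k * cdot \<zeta> \<omega> ^ k * (pochhammer (of_real (\<nu> + 2 * real l)) k / fact k)"
  proof -
    have "u ^ k = (- 1) ^ k * (cnj t ^ k * cdot \<zeta> \<omega> ^ k)"
      unfolding u_def by (subst power_minus) (simp add: power_mult_distrib)
    moreover have "a gchoose k = (- 1) ^ k * (pochhammer (of_real (\<nu> + 2 * real l)) k / fact k)"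
      by (simp only: gbinomial_pochhammer a_def minus_minus times_divide_eq_right)
    moreover have "(- 1) ^ k * (- 1) ^ k = (1 :: complex)"
      by (simp flip: power_mult_distrib)
    ultimately show ?thesis
      by (metis (no_types, lifting) mult.assoc mult.left_commute mult_1)
  qed
  show ?thesis
    unfolding 1[symmetric] 2 3 by (simp add: power_add mult_ac)
qed

text \<open>Cauchy's inequality on circles of radius \<open>R / 4\<close> about points of the
  half-size ball bounds the derivative of order \<open>k + 1\<close>; its factorial over
  \<open>fact k\<close> from the remainder leaves \<open>k + 1\<close>. Linearity in
  \<open>B\<close> later yields a multiple of \<open>nrm \<Phi>\<close>.\<close>

lemma Taylor_bound_ball:
  assumes f: "f holomorphic_on ball 0 R" and B: "\<And>x. x \<in> ball 0 R \<Longrightarrow> norm (f x) \<le> B"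
    and R: "R > 0" and t: "norm t \<le> R / 2"
  shows "norm (f t - (\<Sum>i\<le>k. (deriv ^^ i) f 0 / fact i * t ^ i))
    \<le> B * (real (k + 1) * (4 / R) ^ (k + 1)) * norm t ^ (k + 1)"
proof -
  have sub: "ball (0::complex) R \<supseteq> cball x (R / 4)" if "x \<in> cball 0 (R / 2)" for x
  proof
    fix y assume "y \<in> cball x (R / 4)"
    then show "y \<in> ball 0 R"
      using that R dist_triangle[of 0 y x] by auto
  qed
  have bd: "norm ((deriv ^^ Suc k) f x) \<le> fact (Suc k) * B / (R / 4) ^ Suc k" if x: "x \<in> cball 0 (R / 2)" for x
  proof (rule Cauchy_inequality)
    show "f holomorphic_on ball x (R / 4)" "continuous_on (cball x (R / 4)) f"
      using f sub[OF x] holomorphic_on_subset ball_subset_cball holomorphic_on_imp_continuous_on by blast+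
    show "norm (f y) \<le> B" if "norm (x - y) = R / 4" for y
      using sub[OF x] that by (intro B) (auto simp: dist_norm)
  qed (use R in auto)
  have "norm ((deriv ^^ 0) f t - (\<Sum>i\<le>k. (deriv ^^ i) f 0 * (t - 0) ^ i / fact i))
      \<le> fact (Suc k) * B / (R / 4) ^ Suc k * norm (t - 0) ^ Suc k / fact k"
  proof (rule complex_Taylor[of "cball 0 (R / 2)"])
    show "((deriv ^^ i) f has_field_derivative (deriv ^^ Suc i) f x) (at x within cball 0 (R / 2))"
      if "x \<in> cball 0 (R / 2)" for i x
      using has_field_derivative_higher_deriv[OF f open_ball, of x i] that R
      by (auto intro: has_field_derivative_at_within)
  qed (use bd R t in auto)
  moreover have "fact (Suc k) * B / (R / 4) ^ Suc k * norm (t - 0) ^ Suc k / fact k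
      = B * (real (k + 1) * (4 / R) ^ (k + 1)) * norm t ^ (k + 1)"
  proof -
    have "(4 / R) ^ (k + 1) = 1 / (R / 4) ^ Suc k"
      by (simp add: power_divide)
    then show ?thesis
      unfolding fact_Suc by (simp del: power_Suc)
  qed
  ultimately show ?thesis
    by (simp add: mult.commute)
qed

section \<open>Taylor coefficients as functionals on the Hilbert space\<close>

context H2_space
begin

text \<open>The vector representing evaluation of \<Phi> at base point \<open>t *s \<omega>\<close>
  and argument \<omega>, because \<open>Ekernel\<close> represents evaluation at \<omega>.\<close>

definition ray_kernel :: "complex ^ 'd \<Rightarrow> complex \<Rightarrow> 'd polymap" where
  "ray_kernel \<omega> t = kernel_map \<nu> l (t *s \<omega>) (\<lambda>\<xi>. Ekernel l \<xi> \<omega>)"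

lemma ray_kernel_mem: "t *s \<omega> \<in> D \<Longrightarrow> ray_kernel \<omega> t \<in> H"
  unfolding ray_kernel_def by (intro kernel_mem Ekernel_hom_polys)

lemma ip_ray_kernel:
  assumes "t *s \<omega> \<in> D" "\<Phi> \<in> H"
  shows "ip (ray_kernel \<omega> t) \<Phi> = \<Phi> (t *s \<omega>) \<omega>"
proof -
  have "\<Phi> (t *s \<omega>) \<in> hom_polys l"
    using assms holomorphic by (fastforce simp: hol_polymaps_def hom_polys_def)
  then show ?thesis
    using assms by (simp add: ray_kernel_def reproducing Ekernel_hom_polys fock_reproducing)
qed

lemma holomorphic_ray:
  assumes "\<Phi> \<in> H"
  shows "(\<lambda>t. \<Phi> (t *s \<omega>) \<omega>) holomorphic_on ball 0 (1 / (norm \<omega> + 1))"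
proof -
  have "\<Phi> \<in> hol_polymaps l"
    using assms holomorphic by blast
  then obtain a where a: "\<And>\<alpha>. \<alpha> \<in> multi_indices l \<Longrightarrow> holomorphic_D (a \<alpha>)"
      "\<And>z \<zeta>. z \<in> D \<Longrightarrow> \<Phi> z \<zeta> = (\<Sum>\<alpha>\<in>multi_indices l. a \<alpha> z * monomial \<alpha> \<zeta>)"
    unfolding hol_polymaps_def mem_Collect_eq by metis
  have hol: "(\<lambda>t. a \<alpha> (t *s \<omega>)) holomorphic_on ball 0 (1 / (norm \<omega> + 1))" if \<alpha>: "\<alpha> \<in> multi_indices l" for \<alpha>
    unfolding holomorphic_on_def
  proof
    fix t assume "t \<in> ball (0::complex) (1 / (norm \<omega> + 1))"
    then have "t *s \<omega> \<in> D" by (auto intro: scale_in_D_radius)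
    then obtain L where L: "(a \<alpha> has_derivative L) (at (t *s \<omega>))" "\<And>c v. L (c *s v) = c * L v"
      using a(1)[OF \<alpha>] by (auto simp: holomorphic_D_def)
    have "bounded_linear (\<lambda>t. t *s \<omega>)"
      by (intro linear_conv_bounded_linear[THEN iffD1] linearI) (auto simp: vec_eq_iff algebra_simps)
    then have "((\<lambda>t. t *s \<omega>) has_derivative (\<lambda>t. t *s \<omega>)) (at t)"
      by (rule bounded_linear_imp_has_derivative)
    \<comment> \<open>Complex homogeneity of \<open>L\<close> turns the real derivative along the
      ray into multiplication by \<open>L \<omega>\<close>.\<close>
    from has_derivative_compose[OF this L(1)]
    have "((\<lambda>t. a \<alpha> (t *s \<omega>)) has_field_derivative L \<omega>) (at t)"
      by (simp add: L(2) has_field_derivative_def mult.commute[of _ "L \<omega>"])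
    then show "(\<lambda>t. a \<alpha> (t *s \<omega>)) field_differentiable at t within ball 0 (1 / (norm \<omega> + 1))"
      using field_differentiable_def field_differentiable_at_within by blast
  qed
  have "(\<lambda>t. \<Sum>\<alpha>\<in>multi_indices l. a \<alpha> (t *s \<omega>) * monomial \<alpha> \<omega>) holomorphic_on ball 0 (1 / (norm \<omega> + 1))"
    by (intro holomorphic_intros hol)
  then show ?thesis
    by (rule holomorphic_transform) (simp add: a(2) scale_in_D_radius)
qed

text \<open>The squared norm is the kernel on the diagonal, a continuous function of
  \<open>t * cnj t * cdot \<omega> \<omega>\<close>. Halving the radius keeps this argument in a
  compact disc away from the singularity at \<open>1\<close>.\<close>

lemma nrm_ray_kernel_bounded:
  obtains K where "K \<ge> 0" "\<And>t. norm t < 1 / (norm \<omega> + 1) / 2 \<Longrightarrow> nrm (ray_kernel \<omega> t) \<le> K"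
proof -
  define g where "g x = cdot \<omega> \<omega> ^ l / fact l * (1 - x) powr (- of_real (\<nu> + 2 * real l))" for x :: complex
  have "continuous_on (cball 0 (1 / 2)) g"
  proof -
    have "Re (1 - x) > 0" if "x \<in> cball (0::complex) (1 / 2)" for x
      using abs_Re_le_cmod[of x] that by auto
    then show ?thesis
      unfolding g_def
      by (intro continuous_on_mult continuous_on_powr_complex continuous_on_diff continuous_on_const
          continuous_on_id) (force simp: complex_eq_iff)+
  qed
  then have "bounded (g ` cball 0 (1 / 2))"
    by (intro compact_imp_bounded compact_continuous_image) auto
  then obtain K where K: "\<And>x. x \<in> cball 0 (1 / 2) \<Longrightarrow> norm (g x) \<le> K"
    unfolding bounded_iff by (metis imageI)
  have half_le: "q / 2 \<le> q" if "0 < q" for q :: real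
    using that by simp
  have "nrm (ray_kernel \<omega> t) \<le> sqrt K" if t: "norm t < 1 / (norm \<omega> + 1) / 2" for t
  proof -
    have pos: "norm \<omega> + 1 > 0" by (simp add: add_nonneg_pos)
    have "norm t < 1 / (norm \<omega> + 1)"
      using t divide_pos_pos[OF zero_less_one pos] by (rule less_le_trans[OF _ half_le])
    then have D: "t *s \<omega> \<in> D"
      by (rule scale_in_D_radius)
    have "norm t * (norm \<omega> + 1) \<le> 1 / 2"
      using t pos by (simp add: field_simps)
    then have le: "norm (t *s \<omega>) \<le> 1 / 2"
      unfolding norm_smult_vec distrib_left using norm_ge_zero[of t] by linarith
    have "norm (cdot (t *s \<omega>) (t *s \<omega>)) \<le> 1 / 2 * (1 / 2)"
      by (rule order_trans[OF norm_cdot_le mult_mono[OF le le]]) auto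
    then have "t * cnj t * cdot \<omega> \<omega> \<in> cball 0 (1 / 2)"
      by (simp add: cdot_scale_left cdot_scale_right mult_ac)
    from K[OF this] have "norm (ip (ray_kernel \<omega> t) (ray_kernel \<omega> t)) \<le> K"
      using D by (simp add: ip_ray_kernel ray_kernel_mem) (simp add: ray_kernel_def kernel_map_ray g_def)
    then show ?thesis
      unfolding nrm_def by (intro real_sqrt_le_mono order_trans[OF complex_Re_le_cmod])
  qed
  then show ?thesis
    using order_trans[OF norm_ge_zero K[of 0]] by (intro that[of "sqrt K"]) auto
qed

text \<open>The \<open>k\<close>-th Taylor coefficient is the norm limit, as \<open>t\<close> tends to \<open>0\<close>, of the remainders
  of order \<open>k\<close> divided by \<open>t ^ k\<close>, which are combinations of an evaluation functional and of the
  lower coefficients.\<close>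

lemma represents_ray_coeff:
  assumes L: "linear_on_H L"
    and \<sigma>: "\<And>t. t *s \<omega> \<in> D \<Longrightarrow> L (ray_kernel \<omega> t) = (\<Sum>j\<le>N. cnj t ^ j * \<sigma> j)"
    and "k \<le> N"
  shows "represents L (ray_coeff \<omega> k) (\<sigma> k)"
  using \<open>k \<le> N\<close>
proof (induction k rule: less_induct)
  case (less k)
  define R where "R = 1 / (norm \<omega> + 1) / 2"
  have "R > 0" by (simp add: R_def add_nonneg_pos)
  then have R_le: "R \<le> 1 / (norm \<omega> + 1)" unfolding R_def by linarith
  obtain K where K: "K \<ge> 0" "\<And>t. norm t < R \<Longrightarrow> nrm (ray_kernel \<omega> t) \<le> K"
    using nrm_ray_kernel_bounded[of \<omega>] unfolding R_def by blast
  define C where "C = K * (real (k + 1) * (4 / R) ^ (k + 1))"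
  have inD: "t *s \<omega> \<in> D" if "norm t < R" for t
    using that \<open>R > 0\<close> unfolding R_def by (intro scale_in_D_radius) linarith
  \<comment> \<open>Cauchy-Schwarz and the kernel bound \<open>K\<close> control \<Phi> on the ray
    by \<open>K * nrm \<Phi>\<close>, so one constant \<open>C\<close> serves all \<Phi>.\<close>
  have Taylor: "norm (\<Phi> (t *s \<omega>) \<omega> - (\<Sum>i\<le>k. ray_coeff \<omega> i \<Phi> * t ^ i)) \<le> C * nrm \<Phi> * norm t ^ (k + 1)"
    if \<Phi>: "\<Phi> \<in> H" and t: "norm t \<le> R / 2" for \<Phi> t
  proof -
    have "norm (\<Phi> (t *s \<omega>) \<omega> - (\<Sum>i\<le>k. ray_coeff \<omega> i \<Phi> * t ^ i))
        \<le> (K * nrm \<Phi>) * (real (k + 1) * (4 / R) ^ (k + 1)) * norm t ^ (k + 1)"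
      unfolding ray_coeff_def
    proof (rule Taylor_bound_ball[OF _ _ \<open>R > 0\<close> t])
      show "(\<lambda>t. \<Phi> (t *s \<omega>) \<omega>) holomorphic_on ball 0 R"
        by (rule holomorphic_on_subset[OF holomorphic_ray[OF \<Phi>] subset_ball[OF R_le]])
      fix x assume "x \<in> ball (0::complex) R"
      then have x: "norm x < R" by simp
      have "norm (\<Phi> (x *s \<omega>) \<omega>) = norm (ip (ray_kernel \<omega> x) \<Phi>)"
        using inD[OF x] \<Phi> by (simp add: ip_ray_kernel)
      also have "\<dots> \<le> nrm (ray_kernel \<omega> x) * nrm \<Phi>"
        using inD[OF x] \<Phi> by (intro Cauchy_Schwarz_ip ray_kernel_mem)
      also have "\<dots> \<le> K * nrm \<Phi>"
        using K(2)[OF x] nrm_nonneg[OF \<Phi>] by (rule mult_right_mono)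
      finally show "norm (\<Phi> (x *s \<omega>) \<omega>) \<le> K * nrm \<Phi>" .
    qed
    then show ?thesis by (simp add: C_def mult_ac)
  qed
  have split: "(\<Sum>i\<le>k. f i) = (\<Sum>i<k. f i) + f k" for f :: "nat \<Rightarrow> complex"
    by (simp flip: lessThan_Suc_atMost)
  \<comment> \<open>The part of \<open>L (ray_kernel \<omega> t)\<close> beyond order
    \<open>k\<close>, divided by \<open>cnj t ^ k\<close>: all exponents \<open>j - k\<close> are
    positive, so it vanishes in the limit.\<close>
  have "((\<lambda>t. \<Sum>j\<in>{k<..N}. cnj t ^ (j - k) * \<sigma> j) \<longlongrightarrow> (\<Sum>j\<in>{k<..N}. cnj 0 ^ (j - k) * \<sigma> j)) (at 0)"
    by (intro tendsto_intros)
  then have lim1: "((\<lambda>t. \<Sum>j\<in>{k<..N}. cnj t ^ (j - k) * \<sigma> j) \<longlongrightarrow> 0) (at 0)"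
    by (simp add: sum.neutral power_0_left)
  have lim2: "((\<lambda>t. C * norm (t::complex)) \<longlongrightarrow> 0) (at 0)"
    by (rule tendsto_mult_right_zero[OF tendsto_norm_zero[OF tendsto_ident_at]])
  show ?case
  proof (rule represents_limit)
    fix \<epsilon> :: real assume \<epsilon>: "\<epsilon> > 0"
    have "\<forall>\<^sub>F t in at 0. t \<in> ball (0::complex) (R / 2) - {0}"
      using \<open>R > 0\<close> by (intro eventually_at_in_open) auto
    moreover note tendstoD[OF lim1 \<epsilon>] tendstoD[OF lim2 \<epsilon>]
    ultimately have "\<forall>\<^sub>F t in at (0::complex). t \<in> ball 0 (R / 2) - {0} \<and>
        dist (\<Sum>j\<in>{k<..N}. cnj t ^ (j - k) * \<sigma> j) 0 < \<epsilon> \<and> dist (C * norm t) 0 < \<epsilon>"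
      by (intro eventually_conj)
    then obtain t :: complex where t: "norm t < R / 2" "t \<noteq> 0"
        "norm (\<Sum>j\<in>{k<..N}. cnj t ^ (j - k) * \<sigma> j) < \<epsilon>" "\<bar>C * norm t\<bar> < \<epsilon>"
      using eventually_happens[of _ "at (0::complex)"] by (auto simp: dist_norm)
    have D: "t *s \<omega> \<in> D" using t(1) \<open>R > 0\<close> by (intro inD) auto
    let ?S = "\<lambda>\<Phi>. \<Sum>i<k. t ^ i * ray_coeff \<omega> i \<Phi>"
    let ?\<sigma> = "\<Sum>i<k. cnj (t ^ i) * \<sigma> i"
    define M where "M = (\<lambda>\<Phi>. 1 / t ^ k * (ip (ray_kernel \<omega> t) \<Phi> + - 1 * ?S \<Phi>))"
    define s where "s = cnj (1 / t ^ k) * (L (ray_kernel \<omega> t) + cnj (- 1) * ?\<sigma>)"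
    have "represents L M s"
      unfolding M_def s_def
    proof (rule represents_scale[OF L represents_add_scale[OF L represents_ip[OF ray_kernel_mem[OF D]]
          represents_sum[OF L]]])
      show "represents L (ray_coeff \<omega> i) (\<sigma> i)" if "i \<in> {..<k}" for i
        using that less.prems by (intro less.IH) auto
    qed
    moreover have "norm (ray_coeff \<omega> k \<Phi> - M \<Phi>) \<le> \<epsilon> * nrm \<Phi>" if \<Phi>: "\<Phi> \<in> H" for \<Phi>
    proof -
      have "ray_coeff \<omega> k \<Phi> - M \<Phi> = - (\<Phi> (t *s \<omega>) \<omega> - (\<Sum>i\<le>k. ray_coeff \<omega> i \<Phi> * t ^ i)) / t ^ k"
      proof -
        have "(\<Sum>i\<le>k. ray_coeff \<omega> i \<Phi> * t ^ i) = ?S \<Phi> + t ^ k * ray_coeff \<omega> k \<Phi>"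
          by (subst split) (simp add: mult.commute)
        moreover have "x - 1 / T * (p + - 1 * q) = - (p - (q + T * x)) / T" if "T \<noteq> 0" for x p q T :: complex
          using that by (simp add: field_simps)
        ultimately show ?thesis
          using t(2) \<Phi> D by (simp only: M_def ip_ray_kernel power_not_zero not_False_eq_True)
      qed
      then have "norm (ray_coeff \<omega> k \<Phi> - M \<Phi>)
          = norm (\<Phi> (t *s \<omega>) \<omega> - (\<Sum>i\<le>k. ray_coeff \<omega> i \<Phi> * t ^ i)) / norm t ^ k"
        by (simp add: norm_divide norm_power norm_minus_commute)
      also have "\<dots> \<le> C * nrm \<Phi> * norm t ^ (k + 1) / norm t ^ k"
        using Taylor[OF \<Phi>, of t] t(1) by (intro divide_right_mono) auto
      also have "\<dots> = C * norm t * nrm \<Phi>"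
        using t(2) by (simp add: field_simps)
      also have "\<dots> \<le> \<epsilon> * nrm \<Phi>"
        using t(4) nrm_nonneg[OF \<Phi>] by (intro mult_right_mono) auto
      finally show ?thesis .
    qed
    moreover have "norm (\<sigma> k - s) \<le> \<epsilon>"
    proof -
      have "{..N} = insert k ({..<k} \<union> {k<..N})" "{..<k} \<inter> {k<..N} = {}"
        using less.prems by auto
      then have "(\<Sum>j\<le>N. cnj t ^ j * \<sigma> j) = ?\<sigma> + cnj t ^ k * \<sigma> k + (\<Sum>j\<in>{k<..N}. cnj t ^ j * \<sigma> j)"
        by (simp add: sum.union_disjoint)
      also have "(\<Sum>j\<in>{k<..N}. cnj t ^ j * \<sigma> j) = cnj t ^ k * (\<Sum>j\<in>{k<..N}. cnj t ^ (j - k) * \<sigma> j)"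
        by (auto simp: sum_distrib_left mult.assoc[symmetric] simp flip: power_add intro!: sum.cong)
      finally have "s = \<sigma> k + (\<Sum>j\<in>{k<..N}. cnj t ^ (j - k) * \<sigma> j)"
        using t(2) \<sigma>[OF D] by (simp add: s_def field_simps)
      then show ?thesis
        using t(3) by (simp add: norm_minus_commute)
    qed
    ultimately show "\<exists>M' s'. represents L M' s' \<and>
        (\<forall>\<Phi>\<in>H. norm (ray_coeff \<omega> k \<Phi> - M' \<Phi>) \<le> \<epsilon> * nrm \<Phi>) \<and> norm (\<sigma> k - s') \<le> \<epsilon>"
      by blast
  qed
qed

text \<open>\<open>represents_ray_coeff\<close> is applied twice: at \<zeta>, to make the
  intertwiner value a functional admissible in Parseval's identity, and at \<omega>, with that
  functional as \<open>L\<close>, to compute the sum.\<close>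

lemma has_sum_intertwiner:
  assumes B: "orthonormal_basis H ip B"
  shows "((\<lambda>\<Phi>. intertwiner n \<nu> l \<Phi> 0 \<zeta> * cnj (intertwiner n \<nu> l \<Phi> 0 \<omega>)) has_sum
    (\<Sum>k\<le>n - l. of_real ((pochhammer (real l - real n) k / pochhammer (2 * real l + \<nu>) k)\<^sup>2 *
       (pochhammer (\<nu> + 2 * real l) k / fact k) / fact l) * cdot \<zeta> \<omega> ^ (k + l))) B"
proof -
  define a where "a k = complex_of_real (pochhammer (real l - real n) k / pochhammer (2 * real l + \<nu>) k)" for k
  define b where "b k = complex_of_real (pochhammer (\<nu> + 2 * real l) k / fact k / fact l)" for k
  have T: "intertwiner n \<nu> l \<Phi> 0 \<eta> = (\<Sum>k\<le>n - l. a k * ray_coeff \<eta> k \<Phi>)" for \<Phi> :: "'d polymap" and \<eta>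
    by (simp add: intertwiner_def dir_deriv_def ray_coeff_def a_def)
  have lin0: "linear_on_H (\<lambda>_. 0)"
    by (simp add: linear_on_H_def)
  \<comment> \<open>With the zero functional in place of \<open>L\<close> all values are zero; what
    remains is the approximability of the intertwiner by vectors of \<open>H\<close>.\<close>
  have "represents (\<lambda>_. 0) (\<lambda>\<Phi>. \<Sum>k\<le>n - l. a k * ray_coeff \<zeta> k \<Phi>) (\<Sum>k\<le>n - l. cnj (a k) * 0)"
    by (intro represents_sum lin0 represents_ray_coeff[where N = "n - l" and \<sigma> = "\<lambda>_. 0"]) auto
  then have L: "represents (\<lambda>_. 0) (\<lambda>\<Phi>. intertwiner n \<nu> l \<Phi> 0 \<zeta>) (\<Sum>k\<le>n - l. cnj (a k) * 0)"
    by (simp only: T)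
  \<comment> \<open>Coefficients in \<open>cnj t\<close> of the intertwiner value at
    \<open>ray_kernel \<omega> t\<close>; the cutoff of the intertwiner bounds the degree by
    \<open>n - l\<close>.\<close>
  let ?\<sigma> = "\<lambda>k. a k * b k * cdot \<zeta> \<omega> ^ (k + l)"
  have "represents (\<lambda>\<Phi>. intertwiner n \<nu> l \<Phi> 0 \<zeta>) (\<lambda>\<Phi>. \<Sum>k\<le>n - l. a k * ray_coeff \<omega> k \<Phi>)
      (\<Sum>k\<le>n - l. cnj (a k) * ?\<sigma> k)"
  proof (intro represents_sum represents_imp_linear[OF L] represents_ray_coeff[where N = "n - l" and \<sigma> = ?\<sigma>])
    fix t assume "t *s \<omega> \<in> D"
    then show "intertwiner n \<nu> l (ray_kernel \<omega> t) 0 \<zeta> = (\<Sum>j\<le>n - l. cnj t ^ j * ?\<sigma> j)"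
      by (simp add: T ray_kernel_def ray_coeff_kernel_map b_def mult_ac flip: pochhammer_of_real)
  qed auto
  then have M: "represents (\<lambda>\<Phi>. intertwiner n \<nu> l \<Phi> 0 \<zeta>) (\<lambda>\<Phi>. intertwiner n \<nu> l \<Phi> 0 \<omega>)
      (\<Sum>k\<le>n - l. cnj (a k) * ?\<sigma> k)"
    by (simp only: T)
  have "(\<Sum>k\<le>n - l. cnj (a k) * ?\<sigma> k) =
    (\<Sum>k\<le>n - l. of_real ((pochhammer (real l - real n) k / pochhammer (2 * real l + \<nu>) k)\<^sup>2 *
       (pochhammer (\<nu> + 2 * real l) k / fact k) / fact l) * cdot \<zeta> \<omega> ^ (k + l))"
    by (intro sum.cong) (simp_all add: a_def b_def power2_eq_square mult_ac)
  with has_sum_Parseval[OF B L M] show ?thesis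
    by simp
qed

end

section \<open>Identification with \<open>kappa\<close> and summation over the degrees\<close>

text \<open>Vandermonde's convolution merges the upper arguments into
  \<open>\<nu> + m + l - 1\<close>; as a rising factorial of length \<open>m - l\<close> this starts
  at \<open>\<nu> + 2 * l\<close>.\<close>

lemma kappa_eq:
  assumes "l \<le> m"
  shows "kappa n \<nu> l m = (pochhammer (real l - real n) (m - l) / pochhammer (2 * real l + \<nu>) (m - l))\<^sup>2 *
    (pochhammer (\<nu> + 2 * real l) (m - l) / fact (m - l))"
proof -
  let ?k = "m - l"
  have "(\<Sum>(i, j) | i + j = ?k. ((\<nu> + real m - 1) gchoose i) * (real l gchoose j))
      = (\<Sum>i\<le>?k. ((\<nu> + real m - 1) gchoose i) * (real l gchoose (?k - i)))"
  proof -
    have "(\<Sum>(i, j) | i + j = k. f i * g j) = (\<Sum>i\<le>k. f i * g (k - i))" for f g :: "nat \<Rightarrow> real" and k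
      by (rule sum.reindex_bij_witness[where i = "\<lambda>i. (i, k - i)" and j = fst]) auto
    then show ?thesis .
  qed
  also have "\<dots> = (\<nu> + real m - 1 + real l) gchoose ?k"
    unfolding atMost_atLeast0 by (rule gbinomial_Vandermonde)
  also have "\<dots> = pochhammer (\<nu> + real m - 1 + real l - real ?k + 1) ?k / fact ?k"
    by (rule gbinomial_pochhammer')
  also have "\<nu> + real m - 1 + real l - real ?k + 1 = \<nu> + 2 * real l"
    using assms by (simp add: of_nat_diff)
  finally show ?thesis
    by (simp add: kappa_def add.commute)
qed

theorem theorem4p8:
  fixes n :: nat and \<nu> :: real and c :: "nat \<Rightarrow> real"
    and H :: "nat \<Rightarrow> ('d::finite) polymap set"
    and ip :: "nat \<Rightarrow> 'd polymap \<Rightarrow> 'd polymap \<Rightarrow> complex"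
    and B :: "nat \<Rightarrow> 'd polymap set"
    and \<zeta> \<omega> :: "complex ^ 'd"
  assumes "\<nu> > 0"
    and "\<And>l. l \<le> n \<Longrightarrow> c l > 0"
    and "\<And>l. l \<le> n \<Longrightarrow> H2_space \<nu> l (H l) (ip l)"
    and "\<And>l. l \<le> n \<Longrightarrow> orthonormal_basis (H l) (ip l) (B l)"
  shows "big_kernel n \<nu> c B 0 0 \<zeta> \<omega> =
    (\<Sum>m\<le>n. cdot \<zeta> \<omega> ^ m * of_real (\<Sum>l\<le>m. kappa n \<nu> l m * (c l / fact l)))"
proof -
  have inner: "(\<Sum>\<^sub>\<infinity>\<Phi>\<in>B l. intertwiner n \<nu> l \<Phi> 0 \<zeta> * cnj (intertwiner n \<nu> l \<Phi> 0 \<omega>))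
      = (\<Sum>m\<in>{l..n}. of_real (kappa n \<nu> l m / fact l) * cdot \<zeta> \<omega> ^ m)" if l: "l \<le> n" for l
  proof -
    have "(\<Sum>k\<le>n - l. of_real ((pochhammer (real l - real n) k / pochhammer (2 * real l + \<nu>) k)\<^sup>2 *
         (pochhammer (\<nu> + 2 * real l) k / fact k) / fact l) * cdot \<zeta> \<omega> ^ (k + l))
       = (\<Sum>m\<in>{l..n}. of_real (kappa n \<nu> l m / fact l) * cdot \<zeta> \<omega> ^ m)"
      by (rule sum.reindex_bij_witness[where i = "\<lambda>m. m - l" and j = "\<lambda>k. k + l"])
         (use l in \<open>auto simp: kappa_eq\<close>)
    \<comment> \<open>An infinite sum defaults to zero without summability, so the value is taken
      from \<open>has_sum\<close>.\<close>
    with infsumI[OF H2_space.has_sum_intertwiner[OF assms(3)[OF l] assms(4)[OF l]]] show ?thesis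
      by simp
  qed
  have "big_kernel n \<nu> c B 0 0 \<zeta> \<omega>
      = (\<Sum>l\<in>{..n}. \<Sum>m\<in>{l..n}. of_real (c l) * (of_real (kappa n \<nu> l m / fact l) * cdot \<zeta> \<omega> ^ m))"
    by (simp add: big_kernel_def inner sum_distrib_left)
  also have "\<dots> = (\<Sum>m\<in>{..n}. \<Sum>l\<in>{..m}. of_real (c l) * (of_real (kappa n \<nu> l m / fact l) * cdot \<zeta> \<omega> ^ m))"
    by (subst (1 2) sum.Sigma, simp_all, rule sum.reindex_bij_witness[where i = "\<lambda>(m, l). (l, m)" and j = "\<lambda>(l, m). (m, l)"]) auto
  also have "\<dots> = (\<Sum>m\<le>n. cdot \<zeta> \<omega> ^ m * of_real (\<Sum>l\<le>m. kappa n \<nu> l m * (c l / fact l)))"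
    by (simp add: sum_distrib_left sum_distrib_right mult_ac)
  finally show ?thesis .
qed

end
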